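(* A positive-real function $Y(s)$ can be realized as the driving-point admittance of a one-port network, consisting of one damper, one inerter, and at most three springs, for which the associated three-port spring network $X$ does not have a well-defined admittance, if and only if $Y(s)$ can be written in the form $$Y(s)=\frac{\alpha_3s^3+\alpha_2s^2+\alpha_1s+\alpha_0}{\beta_3s^3+\beta_2s^2+\beta_1s},$$ where $\alpha_0,\alpha_1,\alpha_2,\alpha_3,\beta_1,\beta_2,\beta_3\ge 0$, and one of the following five conditions holds: 1. $\alpha_3=\beta_2=\beta_3=0$ and $\alpha_1,\alpha_2,\beta_1>0$; 2. $\alpha_3=0$, $\beta_2,\beta_3>0$, $\alpha_1\beta_1-\alpha_0\beta_2\ge 0$, $\alpha_1^2+\alpha_0\beta_2^2\ge\alpha_1\beta_1\beta_2$, $\alpha_0\beta_2+\beta_2\beta_1^2\ge\alpha_1\beta_1$, and $\alpha_1\beta_3=\alpha_2\beta_2$; 3. $\beta_2=0$, $\alpha_3,\beta_3>0$, $\alpha_2\beta_1-\alpha_0\beta_3\ge 0$, $\alpha_2^2+\alpha_0\beta_3^2\ge\alpha_2\beta_1\beta_3$, $\alpha_0\beta_3+\beta_3\beta_1^2\ge\alpha_2\beta_1$, and $\alpha_1\beta_3=\alpha_3\beta_1$; 4. $\beta_3=0$, $\alpha_3,\beta_2>0$, $\alpha_1\beta_1-\alpha_0\beta_2\ge 0$, $\alpha_1^2+\alpha_0\beta_2^2\ge\alpha_1\beta_1\beta_2$, $\alpha_0\beta_2+\beta_2\beta_1^2\ge\alpha_1\beta_1$, and $\alpha_3\beta_1=\alpha_2\beta_2$;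 5. $\alpha_3,\beta_2,\beta_3>0$, $\alpha_1\beta_3+\alpha_2\beta_2\ge\alpha_3\beta_1$, $\alpha_2\beta_2+\alpha_3\beta_1\ge\alpha_1\beta_3$, $\alpha_1\beta_3+\alpha_3\beta_1\ge\alpha_2\beta_2$, $\alpha_3=\beta_2\beta_3$, and $\alpha_1^2\beta_3^2+\alpha_2^2\beta_2^2+\alpha_3^2\beta_1^2+4\alpha_0\alpha_3^2=2(\alpha_1\beta_3\alpha_2\beta_2+\alpha_2\beta_2\alpha_3\beta_1+\alpha_3\beta_1\alpha_1\beta_3)$. Furthermore, the networks (a), (b), (c), (d), (e) described in the context, with $b,c>0$ and $k_1,k_2,k_3\ge 0$, can realize Conditions 1, 2, 3, 4, 5, respectively.
   Context: Mechanical networks are built, without levers, from two-terminal elements whose force–velocity admittances (force/velocity in the Laplace variable $s$) are: spring $k/s$ with $k>0$, damper $c$ with $c>0$, inerter $bs$ with $b>0$. Force plays the role of current and velocity of voltage, and Kirchhoff's laws apply as for electrical networks. The driving-point admittance of a one-port network is the ratio of port force to port velocity. A real-rational function $Y(s)$ is positive-real if it is analytic with $\mathrm{Re}\,Y(s)\ge 0$ in $\mathrm{Re}\,s>0$. Given a one-port network with exactly one damper, one inerter and some springs, let $X$ be the three-port network consisting of the springs only, whose three ports are the driving port and the two pairs of nodes to which the damper and the inerter are attached; thus the one-port network is $X$ with two ports terminated by the damper and the inerter. The network $X$ has a well-defined admittance if its three port velocities can be prescribed independently and then determine the port forces uniquely; equivalently, if the three edges (driving port, damper, inerter) contain no circuit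 in the graph of the network. Networks (a spring with $k_i=0$ is absent; "$\parallel$" denotes parallel connection; each network is described as seen from the driving port): (a) $b\parallel c\parallel k_1$, with $Y(s)=\frac{bs^2+cs+k_1}{s}$; (b) $k_1$ in parallel with the series connection of $k_2$ and $(b\parallel c\parallel k_3)$, with $Y(s)=\frac{b(k_1+k_2)s^2+c(k_1+k_2)s+(k_1k_2+k_2k_3+k_1k_3)}{s(bs^2+cs+k_2+k_3)}$; (c) $c\parallel k_1$ in parallel with the series connection of $k_2$ and $(b\parallel k_3)$, with $Y(s)=\frac{bcs^3+b(k_1+k_2)s^2+c(k_2+k_3)s+(k_1k_2+k_2k_3+k_1k_3)}{s(bs^2+k_2+k_3)}$; (d) $b\parallel k_1$ in parallel with the series connection of $k_2$ and $(c\parallel k_3)$, with $Y(s)=\frac{bcs^3+b(k_2+k_3)s^2+c(k_1+k_2)s+(k_1k_2+k_2k_3+k_1k_3)}{s(cs+k_2+k_3)}$; (e) $k_1$ in parallel with the series connection of $(b\parallel k_3)$ and $(c\parallel k_2)$, with $Y(s)=\frac{bcs^3+b(k_1+k_2)s^2+c(k_1+k_3)s+(k_1k_2+k_2k_3+k_1k_3)}{s(bs^2+cs+k_2+k_3)}$. *)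

theory Defs
  imports
    "HOL-Analysis.Complex_Analysis_Basics"
    "HOL-Computational_Algebra.Computational_Algebra"
    "HOL-Computational_Algebra.Field_as_Ring"
begin

section \<open>Real-rational and positive-real functions\<close>

text \<open>The field $R(s)$; forces, velocities and admittances are Laplace transforms in this field.\<close>

type_synonym ratfun = "real poly fract"

text \<open>\<^const>\<open>quot_of_fract\<close> returns a coprime pair (numerator, denominator).  Hence the
  function below has a genuine singularity at every zero of the denominator, although division
  by zero is total, and it is analytic exactly where the rational function has no pole.\<close>

definition rat_eval :: "ratfun \<Rightarrow> complex \<Rightarrow> complex" where
  "rat_eval Y s =
     poly (map_poly complex_of_real (fst (quot_of_fract Y))) s /
     poly (map_poly complex_of_real (snd (quot_of_fract Y))) s"

definition positive_real :: "ratfun \<Rightarrow> bool" where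
  "positive_real Y \<longleftrightarrow>
     rat_eval Y analytic_on {s. Re s > 0} \<and> (\<forall>s. Re s > 0 \<longrightarrow> Re (rat_eval Y s) \<ge> 0)"


section \<open>Networks and Kirchhoff's laws\<close>

datatype element = Spring real | Damper real | Inerter real

fun admittance :: "element \<Rightarrow> ratfun" where
  "admittance (Spring k) = Fract [:k:] [:0, 1:]"
| "admittance (Damper c) = Fract [:c:] 1"
| "admittance (Inerter b) = Fract [:0, b:] 1"

fun parameter :: "element \<Rightarrow> real" where
  "parameter (Spring k) = k"
| "parameter (Damper c) = c"
| "parameter (Inerter b) = b"

text \<open>An oriented pair of nodes.  The orientation is only a sign convention for the force and the
  velocity; parallel edges are allowed and the graph need not be connected.\<close>

type_synonym edge = "nat \<times> nat"

datatype network = Network (ports: "edge list") (branches: "(edge \<times> element) list")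

definition valid_network :: "network \<Rightarrow> bool" where
  "valid_network N \<longleftrightarrow>
     (\<forall>p\<in>set (ports N). fst p \<noteq> snd p) \<and>
     (\<forall>(e, x)\<in>set (branches N). fst e \<noteq> snd e \<and> parameter x > 0)"

definition velocity_across :: "(nat \<Rightarrow> ratfun) \<Rightarrow> edge \<Rightarrow> ratfun" where
  "velocity_across u e = u (fst e) - u (snd e)"

definition incidence :: "nat \<Rightarrow> edge \<Rightarrow> ratfun" where
  "incidence n e = (if n = fst e then 1 else 0) - (if n = snd e then 1 else 0)"

text \<open>\<open>u\<close> assigns velocities to the nodes and \<open>F\<close> lists the port forces.  The velocity law holds
  because all relative velocities are differences of node velocities; the force law says that at
  every node the element forces leaving it balance the port forces entering it.\<close>

definition kirchhoff :: "network \<Rightarrow> (nat \<Rightarrow> ratfun) \<Rightarrow> ratfun list \<Rightarrow> bool" where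
  "kirchhoff N u F \<longleftrightarrow>
     length F = length (ports N) \<and>
     (\<forall>n. (\<Sum>(e, x)\<leftarrow>branches N. incidence n e * (admittance x * velocity_across u e)) =
          (\<Sum>(p, f)\<leftarrow>zip (ports N) F. incidence n p * f))"

definition driving_point_admittance :: "network \<Rightarrow> ratfun \<Rightarrow> bool" where
  "driving_point_admittance N Y \<longleftrightarrow>
     (\<exists>p. ports N = [p] \<and>
        (\<exists>u f. kirchhoff N u [f] \<and> velocity_across u p \<noteq> 0) \<and>
        (\<forall>u f. kirchhoff N u [f] \<longrightarrow> f = Y * velocity_across u p))"

definition well_defined_admittance :: "network \<Rightarrow> bool" where
  "well_defined_admittance N \<longleftrightarrow>
     (\<forall>V. length V = length (ports N) \<longrightarrow>
        (\<exists>!F. \<exists>u. map (velocity_across u) (ports N) = V \<and> kirchhoff N u F))"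


section \<open>One-port networks with one damper, one inerter and springs\<close>

record dis_network =
  driving_port :: edge
  damper :: "edge \<times> real"
  inerter :: "edge \<times> real"
  springs :: "(edge \<times> real) list"

definition spring_branches :: "dis_network \<Rightarrow> (edge \<times> element) list" where
  "spring_branches D = map (\<lambda>(e, k). (e, Spring k)) (springs D)"

definition one_port :: "dis_network \<Rightarrow> network" where
  "one_port D =
     Network [driving_port D]
       ((fst (damper D), Damper (snd (damper D))) #
        (fst (inerter D), Inerter (snd (inerter D))) # spring_branches D)"

definition spring_three_port :: "dis_network \<Rightarrow> network" where
  "spring_three_port D =
     Network [driving_port D, fst (damper D), fst (inerter D)] (spring_branches D)"


section \<open>The networks (a) to (e)\<close>

text \<open>The driving port is (0, 1) throughout; node 2 is the internal node of the series connection.\<close>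

definition spring_at :: "edge \<Rightarrow> real \<Rightarrow> (edge \<times> real) list" where
  "spring_at e k = (if k = 0 then [] else [(e, k)])"

definition network_a :: "real \<Rightarrow> real \<Rightarrow> real \<Rightarrow> dis_network" where
  "network_a b c k1 =
     \<lparr>driving_port = (0, 1), damper = ((0, 1), c), inerter = ((0, 1), b),
      springs = spring_at (0, 1) k1\<rparr>"

definition network_b :: "real \<Rightarrow> real \<Rightarrow> real \<Rightarrow> real \<Rightarrow> real \<Rightarrow> dis_network" where
  "network_b b c k1 k2 k3 =
     \<lparr>driving_port = (0, 1), damper = ((2, 1), c), inerter = ((2, 1), b),
      springs = spring_at (0, 1) k1 @ spring_at (0, 2) k2 @ spring_at (2, 1) k3\<rparr>"

definition network_c :: "real \<Rightarrow> real \<Rightarrow> real \<Rightarrow> real \<Rightarrow> real \<Rightarrow> dis_network" where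
  "network_c b c k1 k2 k3 =
     \<lparr>driving_port = (0, 1), damper = ((0, 1), c), inerter = ((2, 1), b),
      springs = spring_at (0, 1) k1 @ spring_at (0, 2) k2 @ spring_at (2, 1) k3\<rparr>"

definition network_d :: "real \<Rightarrow> real \<Rightarrow> real \<Rightarrow> real \<Rightarrow> real \<Rightarrow> dis_network" where
  "network_d b c k1 k2 k3 =
     \<lparr>driving_port = (0, 1), damper = ((2, 1), c), inerter = ((0, 1), b),
      springs = spring_at (0, 1) k1 @ spring_at (0, 2) k2 @ spring_at (2, 1) k3\<rparr>"

definition network_e :: "real \<Rightarrow> real \<Rightarrow> real \<Rightarrow> real \<Rightarrow> real \<Rightarrow> dis_network" where
  "network_e b c k1 k2 k3 =
     \<lparr>driving_port = (0, 1), damper = ((2, 1), c), inerter = ((0, 2), b),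
      springs = spring_at (0, 1) k1 @ spring_at (2, 1) k2 @ spring_at (0, 2) k3\<rparr>"


section \<open>The coefficient conditions\<close>

text \<open>The arguments are $\alpha_0, \alpha_1, \alpha_2, \alpha_3, \beta_1, \beta_2, \beta_3$, in
  this order.  Each condition forces some $\beta_i > 0$, so together with it the denominator in
  \<open>has_form\<close> is nonzero.\<close>

definition has_form ::
  "ratfun \<Rightarrow> real \<Rightarrow> real \<Rightarrow> real \<Rightarrow> real \<Rightarrow> real \<Rightarrow> real \<Rightarrow> real \<Rightarrow> bool" where
  "has_form Y a0 a1 a2 a3 b1 b2 b3 \<longleftrightarrow>
     a0 \<ge> 0 \<and> a1 \<ge> 0 \<and> a2 \<ge> 0 \<and> a3 \<ge> 0 \<and> b1 \<ge> 0 \<and> b2 \<ge> 0 \<and> b3 \<ge> 0 \<and>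
     Y = Fract [:a0, a1, a2, a3:] [:0, b1, b2, b3:]"

definition condition1 ::
  "real \<Rightarrow> real \<Rightarrow> real \<Rightarrow> real \<Rightarrow> real \<Rightarrow> real \<Rightarrow> real \<Rightarrow> bool" where
  "condition1 a0 a1 a2 a3 b1 b2 b3 \<longleftrightarrow>
     a3 = 0 \<and> b2 = 0 \<and> b3 = 0 \<and> a1 > 0 \<and> a2 > 0 \<and> b1 > 0"

definition condition2 ::
  "real \<Rightarrow> real \<Rightarrow> real \<Rightarrow> real \<Rightarrow> real \<Rightarrow> real \<Rightarrow> real \<Rightarrow> bool" where
  "condition2 a0 a1 a2 a3 b1 b2 b3 \<longleftrightarrow>
     a3 = 0 \<and> b2 > 0 \<and> b3 > 0 \<and>
     a1 * b1 - a0 * b2 \<ge> 0 \<and>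
     a1\<^sup>2 + a0 * b2\<^sup>2 \<ge> a1 * b1 * b2 \<and>
     a0 * b2 + b2 * b1\<^sup>2 \<ge> a1 * b1 \<and>
     a1 * b3 = a2 * b2"

definition condition3 ::
  "real \<Rightarrow> real \<Rightarrow> real \<Rightarrow> real \<Rightarrow> real \<Rightarrow> real \<Rightarrow> real \<Rightarrow> bool" where
  "condition3 a0 a1 a2 a3 b1 b2 b3 \<longleftrightarrow>
     b2 = 0 \<and> a3 > 0 \<and> b3 > 0 \<and>
     a2 * b1 - a0 * b3 \<ge> 0 \<and>
     a2\<^sup>2 + a0 * b3\<^sup>2 \<ge> a2 * b1 * b3 \<and>
     a0 * b3 + b3 * b1\<^sup>2 \<ge> a2 * b1 \<and>
     a1 * b3 = a3 * b1"

definition condition4 ::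
  "real \<Rightarrow> real \<Rightarrow> real \<Rightarrow> real \<Rightarrow> real \<Rightarrow> real \<Rightarrow> real \<Rightarrow> bool" where
  "condition4 a0 a1 a2 a3 b1 b2 b3 \<longleftrightarrow>
     b3 = 0 \<and> a3 > 0 \<and> b2 > 0 \<and>
     a1 * b1 - a0 * b2 \<ge> 0 \<and>
     a1\<^sup>2 + a0 * b2\<^sup>2 \<ge> a1 * b1 * b2 \<and>
     a0 * b2 + b2 * b1\<^sup>2 \<ge> a1 * b1 \<and>
     a3 * b1 = a2 * b2"

definition condition5 ::
  "real \<Rightarrow> real \<Rightarrow> real \<Rightarrow> real \<Rightarrow> real \<Rightarrow> real \<Rightarrow> real \<Rightarrow> bool" where
  "condition5 a0 a1 a2 a3 b1 b2 b3 \<longleftrightarrow>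
     a3 > 0 \<and> b2 > 0 \<and> b3 > 0 \<and>
     a1 * b3 + a2 * b2 \<ge> a3 * b1 \<and>
     a2 * b2 + a3 * b1 \<ge> a1 * b3 \<and>
     a1 * b3 + a3 * b1 \<ge> a2 * b2 \<and>
     a3 = b2 * b3 \<and>
     a1\<^sup>2 * b3\<^sup>2 + a2\<^sup>2 * b2\<^sup>2 + a3\<^sup>2 * b1\<^sup>2 + 4 * a0 * a3\<^sup>2 =
       2 * (a1 * b3 * a2 * b2 + a2 * b2 * a3 * b1 + a3 * b1 * a1 * b3)"

end

theory Submission
  imports Defs
begin

text \<open>If the driving port, the damper and the inerter contain no circuit, the positive definiteness of
  the spring energy makes the three-port \<open>X\<close> well defined.  Otherwise two of these edges are parallel
  or the three form a triangle.  Star-mesh elimination replaces the springs by real nonnegative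
  weights between the at most four end nodes concerned.  For a parallel pair one is left with a
  two-port spring network terminated by a single admittance (condition 1 if all three edges are
  parallel), and the inequalities in conditions 2, 3 and 4 express
  $g_{12}^2 \<ge> 0$, $g_{12}^2 \<le> g_{11}^2$ and $g_{12}^2 \<le> g_{22}^2$ for its matrix $g/s$.  For a triangle
  the three remaining weights are the springs of network (e); the triangle inequalities of
  condition 5 state that they are nonnegative.  Conversely, the spring constants are recovered
  from these relations.\<close>

section \<open>Real constants and the Laplace variable in the field of rational functions\<close>

text \<open>The field R(s) is ordered by the sign of the leading coefficient, so squares are
  nonnegative and s is positive. Energy arguments therefore run inside R(s) without evaluation at
  points, and sums such as \<open>y + z\<close> are nonzero because their terms are nonnegative and
  one is positive. After multiplication by s, springs become real constants. Only springs meet at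
  the nodes to be eliminated, so elimination stays among nonnegative reals although the velocities
  live in R(s). A single solution with nonzero port velocity determines Y: the node equations
  combine to an identity with the port velocity as a factor, and cancelling it leaves the
  coefficient relations. Conditions 2 to 5 are not invariant under a common factor of numerator and
  denominator. The scaling used throughout makes a positive beta_2 the damper constant and a
  positive beta_3 the inertance; in conditions 3 and 4 the leading quotient of Y supplies the other
  element.\<close>

definition cst :: "real \<Rightarrow> ratfun" where
  "cst k = to_fract [:k:]"

definition svar :: ratfun where
  "svar = to_fract [:0, 1:]"

lemma cst_simps [simp]:
  "cst 0 = 0" "cst 1 = 1" "cst (x + y) = cst x + cst y" "cst (x - y) = cst x - cst y"
  "cst (- x) = - cst x" "cst (x * y) = cst x * cst y"
proof -
  show "cst (x + y) = cst x + cst y" "cst (x - y) = cst x - cst y" "cst (- x) = - cst x"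
    unfolding cst_def by (simp_all flip: to_fract_add to_fract_diff to_fract_uminus)
  show "cst (x * y) = cst x * cst y"
    unfolding cst_def by (simp flip: to_fract_mult)
  show "cst 1 = 1" "cst 0 = 0"
    by (simp_all add: cst_def flip: one_pCons)
qed

lemma cst_eq_0_iff [simp]: "cst x = 0 \<longleftrightarrow> x = 0"
  by (simp add: cst_def)

lemma cst_power [simp]: "cst (x ^ n) = cst x ^ n"
  by (induction n) simp_all

lemma cst_divide [simp]: "cst (x / y) = cst x / cst y"
proof (cases "y = 0")
  case False
  then have "cst (x / y) * cst y = cst x"
    by (simp flip: cst_simps(6))
  with False show ?thesis by (simp add: field_simps)
qed simp

lemma cst_sum: "cst (sum f A) = (\<Sum>x\<in>A. cst (f x))"
  by (induction A rule: infinite_finite_induct) simp_all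

lemma to_fract_pos_iff: "to_fract (p :: real poly) > 0 \<longleftrightarrow> pos_poly p"
  using zero_less_Fract_iff[of 1 p] by (simp add: to_fract_def less_poly_def pos_poly_def)

lemma cst_pos_iff [simp]: "cst x > 0 \<longleftrightarrow> x > 0"
  by (simp add: cst_def to_fract_pos_iff pos_poly_pCons)

lemma cst_nonneg_iff [simp]: "cst x \<ge> 0 \<longleftrightarrow> x \<ge> 0"
  by (auto simp: order_le_less)

lemma svar_pos [simp]: "svar > 0"
  by (simp add: svar_def to_fract_pos_iff pos_poly_pCons)

lemma svar_nonzero [simp]: "svar \<noteq> 0"
  using svar_pos by (metis order_less_irrefl)

lemma to_fract_pCons: "to_fract (pCons a p) = cst a + svar * to_fract p"
  unfolding cst_def svar_def by (simp flip: to_fract_add to_fract_mult)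

lemma Fract_eq_divide: "Fract p q = to_fract p / to_fract (q :: real poly)"
  by (cases "q = 0") (simp_all add: to_fract_def fract_collapse)

lemma admittance_simps:
  "admittance (Spring k) = cst k / svar"
  "admittance (Damper k) = cst k"
  "admittance (Inerter k) = cst k * svar"
  by (simp_all add: Fract_eq_divide to_fract_pCons mult.commute)

declare admittance.simps [simp del] admittance_simps [simp]

section \<open>Edge flows and the spring Laplacian\<close>

definition ends :: "edge \<Rightarrow> nat set" where
  "ends e = {fst e, snd e}"

lemma finite_ends [simp]: "finite (ends e)"
  by (simp add: ends_def)

text \<open>Incidence and velocity both change sign when an edge is reversed, so their product depends
  only on the set of end nodes.  Writing the port force as $Y$ times the port velocity makes the
  whole of Kirchhoff's force law independent of orientations.\<close>

definition flow :: "(nat \<Rightarrow> ratfun) \<Rightarrow> edge \<Rightarrow> nat \<Rightarrow> ratfun" where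
  "flow u e n = incidence n e * velocity_across u e"

lemma flow_eq: "flow u (a, b) n = (if n = a then u a - u b else if n = b then u b - u a else 0)"
  by (auto simp: flow_def incidence_def velocity_across_def)

lemma flow_cong_ends: "ends e = ends e' \<Longrightarrow> flow u e n = flow u e' n"
  by (cases e; cases e') (auto simp: ends_def flow_eq doubleton_eq_iff)

text \<open>The spring Laplacian multiplied by $s$, so that its coefficients are real.\<close>

definition lap :: "(edge \<times> real) list \<Rightarrow> (nat \<Rightarrow> ratfun) \<Rightarrow> nat \<Rightarrow> ratfun" where
  "lap sp u n = (\<Sum>(e, k)\<leftarrow>sp. cst k * flow u e n)"

lemma lap_simps [simp]:
  "lap [] u n = 0" "lap ((e, k) # sp) u n = cst k * flow u e n + lap sp u n"
  "lap (sp @ sp') u n = lap sp u n + lap sp' u n"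
  by (simp_all add: lap_def)

lemma lap_spring_at [simp]: "lap (spring_at e k) u n = cst k * flow u e n"
  by (simp add: spring_at_def)

lemma sum_list_spring_branches:
  "(\<Sum>(e, x)\<leftarrow>spring_branches D. incidence n e * (admittance x * velocity_across u e))
    = lap (springs D) u n / svar"
proof -
  have "(\<Sum>(e, x)\<leftarrow>map (\<lambda>(e, k). (e, Spring k)) sp.
      incidence n e * (admittance x * velocity_across u e)) = lap sp u n / svar" for sp
    by (induction sp) (auto simp: flow_def add_divide_distrib)
  then show ?thesis by (simp add: spring_branches_def)
qed

lemma kirchhoff_one_port:
  "kirchhoff (one_port D) u [f] \<longleftrightarrow>
    (\<forall>n. cst (snd (damper D)) * flow u (fst (damper D)) n
       + cst (snd (inerter D)) * svar * flow u (fst (inerter D)) n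
       + lap (springs D) u n / svar = incidence n (driving_port D) * f)"
  by (simp add: kirchhoff_def one_port_def sum_list_spring_branches) (simp add: flow_def ac_simps)

section \<open>Elimination of internal nodes\<close>

text \<open>Elimination couples nodes that no spring joins, so it acts on a symmetric weight matrix
  instead of the list of springs. Diagonal entries are harmless because they multiply
  \<open>u n - u n\<close>.\<close>

definition weight :: "(edge \<times> real) list \<Rightarrow> nat \<Rightarrow> nat \<Rightarrow> real" where
  "weight sp n m = (\<Sum>(e, k)\<leftarrow>sp. if ends e = {n, m} then k else 0)"

lemma weight_commute: "weight sp n m = weight sp m n"
  by (simp add: weight_def insert_commute)

lemma weight_nonneg: "\<forall>(e, k)\<in>set sp. k \<ge> 0 \<Longrightarrow> weight sp n m \<ge> 0"
  by (fastforce simp: weight_def intro!: sum_list_nonneg)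

lemma flow_weight:
  assumes "finite N" "ends e \<subseteq> N"
  shows "flow u e n = (\<Sum>m\<in>N. cst (if ends e = {n, m} then 1 else 0) * (u n - u m))"
proof -
  obtain a b where e: "e = (a, b)" by fastforce
  have ab: "a \<in> N" "b \<in> N" using assms e by (auto simp: ends_def)
  \<comment> \<open>Only the end opposite to \<open>n\<close> contributes. If \<open>n\<close> is no
    end of \<open>e\<close>, then \<open>flow u e n\<close> is 0 and any index may be
    picked.\<close>
  have "(\<Sum>m\<in>N. cst (if ends e = {n, m} then 1 else 0) * (u n - u m))
      = (\<Sum>m\<in>N. if m = (if n = a then b else a) then flow u e n else 0)"
    by (intro sum.cong refl) (auto simp: e ends_def flow_eq doubleton_eq_iff)
  also have "\<dots> = flow u e n" using assms(1) ab by simp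
  finally show ?thesis ..
qed

lemma lap_eq_weight:
  assumes "finite N" "\<forall>(e, k)\<in>set sp. ends e \<subseteq> N"
  shows "lap sp u n = (\<Sum>m\<in>N. cst (weight sp n m) * (u n - u m))"
  using assms(2)
proof (induction sp)
  case (Cons x sp)
  obtain e k where x: "x = (e, k)" by fastforce
  have "cst k * flow u e n = (\<Sum>m\<in>N. cst (if ends e = {n, m} then k else 0) * (u n - u m))"
    using Cons.prems x by (subst flow_weight[OF assms(1)]) (auto simp: sum_distrib_left intro!: sum.cong)
  then show ?case
    using Cons x by (simp add: weight_def sum.distrib distrib_right)
qed (simp add: weight_def)

text \<open>\<open>A\<close> holds the internal nodes and \<open>T\<close> the terminals. Force
  balance at an internal node \<open>x\<close> makes \<open>u x\<close> the weighted mean of its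
  neighbours; substituting it couples each pair of neighbours by the product of their weights to
  \<open>x\<close> divided by the total weight at \<open>x\<close>. This is a Schur complement of
  the Laplacian, and it keeps weights symmetric and nonnegative. Each elimination changes the
  weights, hence the induction with \<open>w\<close> arbitrary.\<close>

lemma star_mesh:
  fixes w :: "nat \<Rightarrow> nat \<Rightarrow> real"
  assumes "finite A" "finite T" "A \<inter> T = {}" "\<And>n m. w n m = w m n" "\<And>n m. w n m \<ge> 0"
  shows "\<exists>w' :: nat \<Rightarrow> nat \<Rightarrow> real. (\<forall>n m. w' n m = w' m n) \<and> (\<forall>n m. w' n m \<ge> 0) \<and>
    (\<forall>u. (\<forall>n\<in>A. (\<Sum>m\<in>A \<union> T. cst (w n m) * (u n - u m)) = 0) \<longrightarrow>
      (\<forall>n\<in>T. (\<Sum>m\<in>A \<union> T. cst (w n m) * (u n - u m)) = (\<Sum>m\<in>T. cst (w' n m) * (u n - u m))))"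
  using assms(1,3,4,5)
proof (induction A arbitrary: w rule: finite_induct)
  case empty
  then show ?case by (intro exI[of _ w]) auto
next
  case (insert x A)
  define B where "B = A \<union> T"
  have B: "finite B" "x \<notin> B" "insert x A \<union> T = insert x B"
    using insert assms(2) by (auto simp: B_def)
  define d where "d = (\<Sum>m\<in>B. w x m)"
  \<comment> \<open>If $d = 0$, then \<open>x\<close> is isolated and division by zero leaves the weights unchanged.\<close>
  define w1 where "w1 n m = w n m + w n x * w x m / d" for n m
  have d: "d \<ge> 0" unfolding d_def by (simp add: sum_nonneg insert.prems)
  have w1: "w1 n m = w1 m n" "w1 n m \<ge> 0" for n m
    using d insert.prems(2)[of n m] insert.prems(2)[of n x] insert.prems(2)[of m x] insert.prems(3)
    by (simp_all add: w1_def)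
  have elim: "(\<Sum>m\<in>insert x B. cst (w n m) * (u n - u m)) = (\<Sum>m\<in>B. cst (w1 n m) * (u n - u m))"
    if x: "(\<Sum>m\<in>insert x B. cst (w x m) * (u x - u m)) = 0" and n: "n \<in> B" for u n
  proof (cases "d = 0")
    case True
    then have "w x n = 0"
      using B n insert.prems(3) unfolding d_def by (simp add: sum_nonneg_eq_0_iff)
    then have "w n x = 0" using insert.prems(2) by metis
    with True B show ?thesis by (simp add: w1_def)
  next
    case False
    have "cst d * u x = (\<Sum>m\<in>B. cst (w x m) * u m)"
      using x B by (simp add: right_diff_distrib sum_subtractf d_def cst_sum sum_distrib_right)
    then have "(\<Sum>m\<in>B. cst (w x m) * (u n - u m)) = cst d * (u n - u x)"
      by (simp add: right_diff_distrib sum_subtractf d_def cst_sum sum_distrib_right)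
    then have "cst (w n x) * (u n - u x) = cst (w n x) / cst d * (\<Sum>m\<in>B. cst (w x m) * (u n - u m))"
      using False by simp
    also have "\<dots> = (\<Sum>m\<in>B. cst (w n x * w x m / d) * (u n - u m))"
      by (simp add: sum_distrib_left mult.assoc)
    finally show ?thesis
      using B by (simp add: w1_def distrib_right sum.distrib)
  qed
  obtain w' :: "nat \<Rightarrow> nat \<Rightarrow> real" where w': "\<forall>n m. w' n m = w' m n" "\<forall>n m. w' n m \<ge> 0"
    "\<And>u. (\<forall>n\<in>A. (\<Sum>m\<in>A \<union> T. cst (w1 n m) * (u n - u m)) = 0) \<Longrightarrow>
      (\<forall>n\<in>T. (\<Sum>m\<in>A \<union> T. cst (w1 n m) * (u n - u m)) = (\<Sum>m\<in>T. cst (w' n m) * (u n - u m)))"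
    using insert.IH[of w1] insert.prems(1) w1 by blast
  show ?case
  proof (intro exI[of _ w'] conjI allI impI w')
    fix u assume *: "\<forall>n\<in>insert x A. (\<Sum>m\<in>insert x A \<union> T. cst (w n m) * (u n - u m)) = 0"
    then have e: "(\<Sum>m\<in>insert x B. cst (w n m) * (u n - u m)) = (\<Sum>m\<in>B. cst (w1 n m) * (u n - u m))"
      if "n \<in> B" for n using elim that B(3) by simp
    show "\<forall>n\<in>T. (\<Sum>m\<in>insert x A \<union> T. cst (w n m) * (u n - u m)) = (\<Sum>m\<in>T. cst (w' n m) * (u n - u m))"
      using w'(3)[of u] * e unfolding B(3) unfolding B_def by auto
  qed (use w' in auto)
qed

lemma spring_reduction:
  assumes "finite T" "\<forall>(e, k)\<in>set sp. k \<ge> 0"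
  obtains w :: "nat \<Rightarrow> nat \<Rightarrow> real"
  where "\<And>n m. w n m = w m n" "\<And>n m. w n m \<ge> 0"
    "\<And>u n. (\<And>n. n \<notin> T \<Longrightarrow> lap sp u n = 0) \<Longrightarrow> n \<in> T \<Longrightarrow>
       lap sp u n = (\<Sum>m\<in>T. cst (w n m) * (u n - u m))"
proof -
  \<comment> \<open>The infinitely many remaining nodes touch no spring, so a finite set of internal
    nodes is enough.\<close>
  define A where "A = (\<Union>(e, k)\<in>set sp. ends e) - T"
  have A: "finite A" "A \<inter> T = {}" by (auto simp: A_def case_prod_beta)
  have lap: "lap sp u n = (\<Sum>m\<in>A \<union> T. cst (weight sp n m) * (u n - u m))" for u n
    by (rule lap_eq_weight) (use assms A in \<open>auto simp: A_def\<close>)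
  obtain w :: "nat \<Rightarrow> nat \<Rightarrow> real"
    where w: "\<forall>n m. w n m = w m n" "\<forall>n m. w n m \<ge> 0"
      "\<forall>u. (\<forall>n\<in>A. lap sp u n = 0) \<longrightarrow> (\<forall>n\<in>T. lap sp u n = (\<Sum>m\<in>T. cst (w n m) * (u n - u m)))"
    using star_mesh[of A T "weight sp", OF A(1) assms(1) A(2) weight_commute weight_nonneg[OF assms(2)]]
    unfolding lap[symmetric] by blast
  show ?thesis
    by (rule that[of w]) (use w A in blast)+
qed

section \<open>Spring networks with independent ports\<close>

lemma velocity_across_incidence:
  assumes "finite N" "ends e \<subseteq> N"
  shows "(\<Sum>n\<in>N. u n * incidence n e) = velocity_across u e"
proof -
  have "(\<Sum>n\<in>N. u n * incidence n e)
      = (\<Sum>n\<in>N. if n = fst e then u n else 0) - (\<Sum>n\<in>N. if n = snd e then u n else 0)"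
    unfolding sum_subtractf[symmetric] by (intro sum.cong) (auto simp: incidence_def)
  with assms show ?thesis by (simp add: ends_def velocity_across_def)
qed

lemma velocity_across_indicator:
  "velocity_across (\<lambda>m. if m = n then 1 else 0) e = incidence n e"
  by (auto simp: velocity_across_def incidence_def)

lemma velocity_across_simps:
  "velocity_across (\<lambda>n. u n + x n) e = velocity_across u e + velocity_across x e"
  "velocity_across (\<lambda>n. u n - x n) e = velocity_across u e - velocity_across x e"
  "velocity_across (\<lambda>n. c * u n) e = c * velocity_across u e"
  "velocity_across (\<lambda>n. \<Sum>p\<in>P. y p n) e = (\<Sum>p\<in>P. velocity_across (y p) e)"
  by (simp_all add: velocity_across_def algebra_simps sum_subtractf)

lemma lap_linear:
  "lap sp (\<lambda>n. u n + x n) m = lap sp u m + lap sp x m"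
  "lap sp (\<lambda>n. u n - x n) m = lap sp u m - lap sp x m"
  "lap sp (\<lambda>n. c * u n) m = c * lap sp u m"
  by (induction sp) (auto simp: flow_def velocity_across_simps algebra_simps)

text \<open>Tellegen's theorem: multiply the force law by arbitrary node velocities \<open>x\<close>
  and sum over the nodes. With \<open>x = u\<close> the left side is a sum of nonnegative terms;
  with an \<open>x\<close> that has unit velocity at one port of \<open>P\<close> and zero at the
  others, the right side isolates one port force.\<close>

lemma energy_balance:
  assumes "finite P" "\<And>n. lap sp u n = (\<Sum>p\<in>P. F p * incidence n p)"
  shows "(\<Sum>(e, k)\<leftarrow>sp. cst k * velocity_across u e * velocity_across x e)
    = (\<Sum>p\<in>P. F p * velocity_across x p)"
proof -
  define N where "N = (\<Union>(e, k)\<in>set sp. ends e) \<union> (\<Union>p\<in>P. ends p)"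
  have N: "finite N" "\<And>e k. (e, k) \<in> set sp \<Longrightarrow> ends e \<subseteq> N" "\<And>p. p \<in> P \<Longrightarrow> ends p \<subseteq> N"
    using assms(1) by (auto simp: N_def case_prod_beta)
  have "(\<Sum>n\<in>N. x n * lap sp u n)
      = (\<Sum>(e, k)\<leftarrow>sp. cst k * velocity_across u e * velocity_across x e)"
    using N(2)
  proof (induction sp)
    case (Cons a sp)
    obtain e k where a: "a = (e, k)" by fastforce
    have "(\<Sum>n\<in>N. x n * (cst k * flow u e n)) = cst k * velocity_across u e * (\<Sum>n\<in>N. x n * incidence n e)"
      by (simp add: flow_def sum_distrib_left ac_simps)
    also have "\<dots> = cst k * velocity_across u e * velocity_across x e"
      using Cons.prems[of e k] a by (subst velocity_across_incidence[OF N(1)]) auto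
    moreover have "(\<Sum>n\<in>N. x n * lap sp u n)
        = (\<Sum>(e, k)\<leftarrow>sp. cst k * velocity_across u e * velocity_across x e)"
      by (rule Cons.IH) (meson Cons.prems list.set_intros(2))
    ultimately show ?case
      by (simp add: a distrib_left sum.distrib)
  qed simp
  moreover have "(\<Sum>n\<in>N. x n * lap sp u n) = (\<Sum>p\<in>P. F p * velocity_across x p)"
  proof -
    have "(\<Sum>n\<in>N. x n * lap sp u n) = (\<Sum>p\<in>P. F p * (\<Sum>n\<in>N. x n * incidence n p))"
      unfolding assms(2) sum_distrib_left by (subst sum.swap) (simp add: ac_simps)
    also have "\<dots> = (\<Sum>p\<in>P. F p * velocity_across x p)"
      using velocity_across_incidence[OF N(1) N(3)] by simp
    finally show ?thesis .
  qed
  ultimately show ?thesis by simp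
qed

text \<open>For finite \<open>P\<close> this is linear independence of the incidence vectors, that
  is, absence of circuits, in dual form. A set cannot record that two ports are the same edge;
  \<open>card P = 3\<close> excludes this where it matters.\<close>

definition realizable :: "edge set \<Rightarrow> bool" where
  "realizable P \<longleftrightarrow> (\<forall>V. \<exists>u. \<forall>p\<in>P. velocity_across u p = V p)"

text \<open>If some \<open>a\<close> has zero velocity on \<open>P\<close> but not across
  \<open>e\<close>, a multiple of it corrects the velocity across \<open>e\<close> without
  disturbing \<open>P\<close>. Otherwise the functional of \<open>e\<close> vanishes on the common
  kernel of those of \<open>P\<close> and is a combination of them; the dual family \<open>d\<close>
  supplies the coefficients.\<close>

lemma realizable_insert_cases:
  assumes "finite P" "realizable P"
  obtains (independent) "e \<notin> P" "realizable (insert e P)"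
  | (dependent) c where "\<And>n. incidence n e = (\<Sum>p\<in>P. c p * incidence n p)"
proof (cases "\<exists>a. (\<forall>p\<in>P. velocity_across a p = 0) \<and> velocity_across a e \<noteq> 0")
  case True
  then obtain a where a: "\<And>p. p \<in> P \<Longrightarrow> velocity_across a p = 0" "velocity_across a e \<noteq> 0"
    by blast
  have "realizable (insert e P)"
    unfolding realizable_def
  proof
    fix V
    obtain u where u: "\<And>p. p \<in> P \<Longrightarrow> velocity_across u p = V p"
      using assms(2) unfolding realizable_def by blast
    define c where "c = (V e - velocity_across u e) / velocity_across a e"
    have c: "c * velocity_across a e = V e - velocity_across u e"
      using a(2) by (simp add: c_def)
    have "velocity_across (\<lambda>n. u n + c * a n) p = V p" if "p \<in> insert e P" for p
      using that a(1) u c by (cases "p = e") (simp_all add: velocity_across_simps)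
    then show "\<exists>u. \<forall>p\<in>insert e P. velocity_across u p = V p" by blast
  qed
  with a show ?thesis using independent by blast
next
  case False
  have "\<exists>d. \<forall>q\<in>P. velocity_across d q = (if q = p then 1 else 0)" for p
    using assms(2)[unfolded realizable_def, rule_format, of "\<lambda>q. if q = p then 1 else 0"] .
  then obtain d where d: "\<And>p q. q \<in> P \<Longrightarrow> velocity_across (d p) q = (if q = p then 1 else 0)"
    by metis
  have "velocity_across u e = (\<Sum>p\<in>P. velocity_across u p * velocity_across (d p) e)" for u
  proof -
    define u' where "u' = (\<lambda>n. u n - (\<Sum>p\<in>P. velocity_across u p * d p n))"
    have "velocity_across u' q = 0" if "q \<in> P" for q
      using that assms(1) by (simp add: u'_def velocity_across_simps d if_distrib cong: if_cong)
    then have "velocity_across u' e = 0" using False by blast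
    then show ?thesis by (simp add: u'_def velocity_across_simps)
  qed
  \<comment> \<open>Evaluation at the indicator of a node turns the relation between functionals
    into one between incidence vectors.\<close>
  from this[of "\<lambda>m. if m = n then 1 else 0" for n] show ?thesis
    by (intro dependent[of "\<lambda>p. velocity_across (d p) e"]) (simp add: velocity_across_indicator mult.commute)
qed

text \<open>Springs are added one at a time.  A spring across dependent nodes only changes the port forces.
  A spring across nodes independent of \<open>P\<close> is first treated as an additional port whose velocity \<open>t\<close>
  is free; its port force is affine in \<open>t\<close> with slope \<open>F1 e \<ge> 0\<close>, the energy stored at unit port
  velocity, so it can be balanced against the spring force \<open>k t\<close>.\<close>

lemma realizable_solution:
  assumes "finite P" "realizable P" "\<forall>(e, k)\<in>set sp. k > 0"
  shows "\<exists>u F. (\<forall>p\<in>P. velocity_across u p = V p) \<and>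
    (\<forall>n. lap sp u n = (\<Sum>p\<in>P. F p * incidence n p))"
  using assms
proof (induction sp arbitrary: P V)
  case Nil
  then obtain u where "\<forall>p\<in>P. velocity_across u p = V p"
    unfolding realizable_def by blast
  then show ?case by (intro exI[of _ u] exI[of _ "\<lambda>p. 0"]) simp
next
  case (Cons a sp)
  obtain e k where a: "a = (e, k)" by fastforce
  have k: "k > 0" "\<forall>(e, k)\<in>set sp. k > 0" using Cons.prems a by auto
  from Cons.prems(1,2) show ?case
  proof (cases rule: realizable_insert_cases[where e = e])
    case (dependent c)
    obtain u F where u: "\<forall>p\<in>P. velocity_across u p = V p"
      and F: "\<And>n. lap sp u n = (\<Sum>p\<in>P. F p * incidence n p)"
      using Cons.IH[OF Cons.prems(1,2) k(2)] by blast
    have "lap (a # sp) u n = (\<Sum>p\<in>P. (F p + cst k * velocity_across u e * c p) * incidence n p)" for n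
      unfolding a lap_simps F flow_def dependent
      by (simp add: sum.distrib sum_distrib_left algebra_simps)
    with u show ?thesis by (intro exI[of _ u] exI conjI allI) auto
  next
    case independent
    note IH = Cons.IH[OF _ independent(2) k(2)]
    obtain u0 F0 where u0: "\<forall>p\<in>insert e P. velocity_across u0 p = (V(e := 0)) p"
      and F0: "\<And>n. lap sp u0 n = (\<Sum>p\<in>insert e P. F0 p * incidence n p)"
      using IH[of "V(e := 0)"] Cons.prems(1) by auto
    obtain u1 F1 where u1: "\<forall>p\<in>insert e P. velocity_across u1 p = ((\<lambda>_. 0)(e := 1)) p"
      and F1: "\<And>n. lap sp u1 n = (\<Sum>p\<in>insert e P. F1 p * incidence n p)"
      using IH[of "(\<lambda>_. 0)(e := 1)"] Cons.prems(1) by auto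
    have "(\<Sum>(e, k)\<leftarrow>sp. cst k * velocity_across u1 e * velocity_across u1 e)
        = (\<Sum>p\<in>insert e P. F1 p * velocity_across u1 p)"
      using Cons.prems(1) F1 by (intro energy_balance) auto
    also have "\<dots> = F1 e"
      using u1 independent(1) Cons.prems(1) by (auto intro!: sum.neutral)
    finally have "F1 e = (\<Sum>(e, k)\<leftarrow>sp. cst k * velocity_across u1 e * velocity_across u1 e)" ..
    also have "\<dots> \<ge> 0"
      using k(2) by (fastforce intro!: sum_list_nonneg simp: mult.assoc less_imp_le)
    finally have pos: "cst k + F1 e > 0" using k(1) by (intro add_pos_nonneg) auto
    define t where "t = - F0 e / (cst k + F1 e)"
    have t: "cst k * t + F0 e + t * F1 e = 0"
      using pos unfolding t_def by (simp add: field_simps)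
    define u where "u = (\<lambda>n. u0 n + t * u1 n)"
    have u: "velocity_across u e = t" "\<And>p. p \<in> P \<Longrightarrow> velocity_across u p = V p"
      using u0 u1 independent(1) by (auto simp: u_def velocity_across_simps)
    have "lap (a # sp) u n = (cst k * t + F0 e + t * F1 e) * incidence n e
        + (\<Sum>p\<in>P. (F0 p + t * F1 p) * incidence n p)" for n
      unfolding a lap_simps flow_def u(1) using Cons.prems(1) independent(1)
      by (simp add: u_def lap_linear F0 F1 algebra_simps sum.distrib sum_distrib_left)
    with u(2) t show ?thesis
      by (intro exI[of _ u] exI[of _ "\<lambda>p. F0 p + t * F1 p"]) simp
  qed
qed

text \<open>The difference of two solutions has zero port velocities, hence zero energy, so no
  spring sees a relative velocity. Pairing it with a velocity that is 1 at \<open>p\<close> and 0 at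
  the other ports then gives equal forces. Node velocities themselves are unique at most up to a
  common shift.\<close>

lemma realizable_force_unique:
  assumes "finite P" "realizable P" "\<forall>(e, k)\<in>set sp. k > 0"
    and F: "\<And>n. lap sp u n = (\<Sum>p\<in>P. F p * incidence n p)"
    and F': "\<And>n. lap sp u' n = (\<Sum>p\<in>P. F' p * incidence n p)"
    and V: "\<And>p. p \<in> P \<Longrightarrow> velocity_across u p = velocity_across u' p"
    and p: "p \<in> P"
  shows "F p = F' p"
proof -
  define d where "d = (\<lambda>n. u n - u' n)"
  define G where "G = (\<lambda>p. F p - F' p)"
  have lap: "lap sp d n = (\<Sum>p\<in>P. G p * incidence n p)" for n
    by (simp add: d_def G_def lap_linear F F' left_diff_distrib sum_subtractf)
  have d: "velocity_across d p = 0" if "p \<in> P" for p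
    using V[OF that] by (simp add: d_def velocity_across_simps)
  have "(\<Sum>(e, k)\<leftarrow>sp. cst k * velocity_across d e * velocity_across d e) = 0"
    using energy_balance[OF assms(1) lap] d by simp
  then have "\<forall>x\<in>set sp. (case x of (e, k) \<Rightarrow> cst k * velocity_across d e * velocity_across d e) = 0"
    using assms(3)
    by (subst (asm) sum_list_nonneg_eq_0_iff) (fastforce simp: mult.assoc less_imp_le)+
  then have v: "velocity_across d e = 0" if "(e, k) \<in> set sp" for e k
    using that assms(3) by fastforce
  have vanish: "(\<Sum>(e, k)\<leftarrow>sp. cst k * velocity_across d e * velocity_across a e) = 0" for a
  proof -
    have "(\<Sum>(e, k)\<leftarrow>sp. cst k * velocity_across d e * velocity_across a e) = (\<Sum>x\<leftarrow>sp. 0)"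
      using v by (intro arg_cong[of _ _ sum_list] map_cong) auto
    then show ?thesis by simp
  qed
  obtain a where a: "\<And>q. q \<in> P \<Longrightarrow> velocity_across a q = (if q = p then 1 else 0)"
    using assms(2)[unfolded realizable_def, rule_format, of "\<lambda>q. if q = p then 1 else 0"] by blast
  have "0 = (\<Sum>q\<in>P. G q * velocity_across a q)"
    using energy_balance[OF assms(1) lap, of a] vanish by simp
  also have "\<dots> = (\<Sum>q\<in>P. if q = p then G q else 0)" using a by (intro sum.cong) simp_all
  also have "\<dots> = G p" using p assms(1) by simp
  finally show ?thesis by (simp add: G_def)
qed

lemma well_defined_if_realizable:
  assumes "valid_network (one_port D)"
    and P: "P = {driving_port D, fst (damper D), fst (inerter D)}" "card P = 3" "realizable P"
  shows "well_defined_admittance (spring_three_port D)"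
proof -
  obtain p0 p1 p2 where p: "driving_port D = p0" "fst (damper D) = p1" "fst (inerter D) = p2" by blast
  have P': "P = {p0, p1, p2}" and dist: "p0 \<noteq> p1" "p0 \<noteq> p2" "p1 \<noteq> p2" and fin: "finite P"
    using P(1,2) p by (auto simp: card_insert_if split: if_splits)
  have sp: "\<forall>(e, k)\<in>set (springs D). k > 0"
    using assms(1) by (force simp: valid_network_def one_port_def spring_branches_def)
  \<comment> \<open>\<open>lap\<close> carries a factor s, so the physical port forces are the
    \<open>F\<close> values divided by \<open>svar\<close>.\<close>
  have k: "kirchhoff (spring_three_port D) u [F p0 / svar, F p1 / svar, F p2 / svar]
      \<longleftrightarrow> (\<forall>n. lap (springs D) u n = (\<Sum>q\<in>P. F q * incidence n q))" for u F
  proof -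
    have "(l / svar = i0 * (f0 / svar) + (i1 * (f1 / svar) + i2 * (f2 / svar)))
        \<longleftrightarrow> l = f0 * i0 + (f1 * i1 + f2 * i2)" for l i0 f0 i1 f1 i2 f2
      by (simp add: field_simps)
    then show ?thesis
      using dist by (simp add: kirchhoff_def spring_three_port_def sum_list_spring_branches p P')
  qed
  show ?thesis
    unfolding well_defined_admittance_def
  proof (intro allI impI)
    fix V :: "ratfun list" assume "length V = length (ports (spring_three_port D))"
    then obtain v0 v1 v2 where V: "V = [v0, v1, v2]"
      by (auto simp: spring_three_port_def length_Suc_conv)
    have map: "map (velocity_across u) (ports (spring_three_port D)) = V
        \<longleftrightarrow> (\<forall>q\<in>P. velocity_across u q = (if q = p0 then v0 else if q = p1 then v1 else v2))" for u
      using dist by (auto simp: spring_three_port_def p V P')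
    obtain u F where u: "\<forall>q\<in>P. velocity_across u q = (if q = p0 then v0 else if q = p1 then v1 else v2)"
      and F: "\<forall>n. lap (springs D) u n = (\<Sum>q\<in>P. F q * incidence n q)"
      using realizable_solution[OF fin P(3) sp, of "\<lambda>q. if q = p0 then v0 else if q = p1 then v1 else v2"] by blast
    show "\<exists>!F. \<exists>u. map (velocity_across u) (ports (spring_three_port D)) = V
        \<and> kirchhoff (spring_three_port D) u F"
    proof (rule ex1I)
      show "\<exists>u. map (velocity_across u) (ports (spring_three_port D)) = V
        \<and> kirchhoff (spring_three_port D) u [F p0 / svar, F p1 / svar, F p2 / svar]"
        unfolding map k using u F by blast
    next
      fix F' assume "\<exists>u. map (velocity_across u) (ports (spring_three_port D)) = V
        \<and> kirchhoff (spring_three_port D) u F'"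
      then obtain u' where u': "map (velocity_across u') (ports (spring_three_port D)) = V"
        and k': "kirchhoff (spring_three_port D) u' F'" by blast
      have "length F' = 3" using k' by (simp add: kirchhoff_def spring_three_port_def)
      then obtain f0 f1 f2 where F': "F' = [f0, f1, f2]"
        by (auto simp: numeral_3_eq_3 length_Suc_conv)
      define G where "G q = svar * (if q = p0 then f0 else if q = p1 then f1 else f2)" for q
      have G: "F' = [G p0 / svar, G p1 / svar, G p2 / svar]"
        using dist by (simp add: F' G_def)
      have "F q = G q" if "q \<in> P" for q
      proof (rule realizable_force_unique[OF fin P(3) sp _ _ _ that])
        show "lap (springs D) u n = (\<Sum>q\<in>P. F q * incidence n q)" for n using F by blast
        show "lap (springs D) u' n = (\<Sum>q\<in>P. G q * incidence n q)" for n
          using k'[unfolded G k] by blast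
        show "velocity_across u q = velocity_across u' q" if "q \<in> P" for q
          using u u'[unfolded map] that by simp
      qed
      then show "F' = [F p0 / svar, F p1 / svar, F p2 / svar]"
        unfolding G by (simp add: P')
    qed
  qed
qed

section \<open>Circuits among the port, damper and inerter edges\<close>

lemma realizable_leaf:
  assumes "realizable P" "x \<in> ends e" "fst e \<noteq> snd e" "\<And>p. p \<in> P \<Longrightarrow> x \<notin> ends p"
  shows "realizable (insert e P)"
  unfolding realizable_def
proof
  fix V
  obtain u where u: "\<And>p. p \<in> P \<Longrightarrow> velocity_across u p = V p"
    using assms(1) unfolding realizable_def by blast
  \<comment> \<open>No edge of \<open>P\<close> touches \<open>x\<close>, so moving \<open>x\<close>
    alone sets the velocity across \<open>e\<close> and changes no other.\<close>
  define u' where "u' = u(x := (if x = fst e then u (snd e) + V e else u (fst e) - V e))"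
  have "velocity_across u' p = V p" if "p \<in> insert e P" for p
  proof (cases "p = e")
    case True
    then show ?thesis using assms(2,3) by (auto simp: u'_def velocity_across_def ends_def)
  next
    case False
    then show ?thesis
      using u[of p] assms(4)[of p] that by (auto simp: u'_def velocity_across_def ends_def)
  qed
  then show "\<exists>u. \<forall>p\<in>insert e P. velocity_across u p = V p" by blast
qed

lemma other_end: "k \<in> ends e \<Longrightarrow> fst e \<noteq> snd e \<Longrightarrow> \<exists>i. i \<noteq> k \<and> ends e = {i, k}"
  by (cases "k = fst e") (auto simp: ends_def intro: exI[of _ "fst e"] exI[of _ "snd e"])

lemma node_outside:
  assumes "fst p \<noteq> snd p" "fst q \<noteq> snd q" "ends p \<noteq> ends q"
  shows "\<exists>x. x \<in> ends p \<and> x \<notin> ends q"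
proof -
  have "fst p \<notin> ends q \<or> snd p \<notin> ends q"
    using assms by (auto simp: ends_def)
  then show ?thesis by (auto simp: ends_def)
qed

lemma realizable_pair:
  assumes "fst p \<noteq> snd p" "fst q \<noteq> snd q" "ends p \<noteq> ends q"
  shows "realizable {p, q}"
proof -
  have "realizable {q}"
    by (rule realizable_leaf[of _ "fst q"]) (use assms in \<open>auto simp: realizable_def ends_def\<close>)
  moreover obtain x where "x \<in> ends p" "x \<notin> ends q"
    using node_outside[OF assms] by blast
  ultimately show ?thesis
    using realizable_leaf[of "{q}" x p] assms by auto
qed

text \<open>An edge with an end outside the other two could be added to that independent pair as a
  leaf. So for pairwise different end sets each edge is covered by the other two, which leaves only
  a triangle. With \<open>i\<close>, \<open>k\<close>, \<open>j\<close> as nodes 0, 1, 2 it is the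
  triangle of network (e).\<close>

lemma circuit_of_not_realizable:
  assumes loops: "fst p \<noteq> snd p" "fst q \<noteq> snd q" "fst r \<noteq> snd r"
    and "\<not> realizable {p, q, r}"
  obtains (parallel) "ends p = ends q \<or> ends p = ends r \<or> ends q = ends r"
  | (triangle) i j k where "i \<noteq> j" "i \<noteq> k" "j \<noteq> k"
      "ends p = {i, k}" "ends q = {j, k}" "ends r = {i, j}"
proof (cases "ends p = ends q \<or> ends p = ends r \<or> ends q = ends r")
  case False
  have *: "ends e \<subseteq> ends e' \<union> ends e''"
    if "{p, q, r} = {e, e', e''}" "fst e \<noteq> snd e" "fst e' \<noteq> snd e'" "fst e'' \<noteq> snd e''" "ends e' \<noteq> ends e''"
    for e e' e''
    using realizable_leaf[OF realizable_pair[OF that(3,4,5)], of _ e] that(1,2) assms(4) by auto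
  have sub: "ends p \<subseteq> ends q \<union> ends r" "ends q \<subseteq> ends p \<union> ends r" "ends r \<subseteq> ends p \<union> ends q"
    using False loops by (intro *; auto)+
  obtain k where k: "k \<in> ends p" "k \<notin> ends r"
    using node_outside[OF loops(1,3)] False by blast
  then have "k \<in> ends q" using sub(1) by blast
  then obtain i j where i: "i \<noteq> k" "ends p = {i, k}" and j: "j \<noteq> k" "ends q = {j, k}"
    using other_end[OF k(1) loops(1)] other_end[OF _ loops(2)] by blast
  have ij: "i \<noteq> j" using False i j by auto
  have "i \<in> ends q \<union> ends r" "j \<in> ends p \<union> ends r" using sub(1,2) i(2) j(2) by blast+
  then have "i \<in> ends r" "j \<in> ends r" using i j ij by auto
  then have "ends r = {i, j}" using ij by (auto simp: ends_def)
  then show ?thesis using triangle[OF ij i(1) j(1) i(2) j(2)] by blast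
qed (rule parallel)

section \<open>Admittances seen from the driving port\<close>

lemma flow_off_ends: "n \<notin> ends e \<Longrightarrow> flow u e n = 0"
  by (auto simp: flow_def incidence_def ends_def)

lemma flow_of_ends:
  "ends e = {a, b} \<Longrightarrow>
    flow u e n = (if n = a then u a - u b else if n = b then u b - u a else 0)"
  using flow_cong_ends[of e "(a, b)"] by (simp add: ends_def flow_eq)

lemma velocity_across_nonzero: "ends e = {a, b} \<Longrightarrow> velocity_across u e \<noteq> 0 \<Longrightarrow> u a \<noteq> u b"
  by (auto simp: ends_def velocity_across_def doubleton_eq_iff)

text \<open>\<open>x\<close> bridges the port i-k, in parallel with the series connection of
  \<open>z\<close> and \<open>y\<close> through j, so Y = x + yz/(y + z). The product form also
  covers \<open>y + z = 0\<close>.\<close>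

lemma three_node_admittance:
  fixes x y z Y ui uj uk :: "'a :: field"
  assumes "x * (ui - uk) + z * (ui - uj) = Y * (ui - uk)"
    and "y * (uj - uk) + z * (uj - ui) = 0" and "ui \<noteq> uk"
  shows "Y * (y + z) = x * y + y * z + z * x"
proof -
  have "(Y * (y + z) - (x * y + y * z + z * x)) * (ui - uk) = 0"
    using assms(1,2) by algebra
  with assms(3) show ?thesis by simp
qed

text \<open>The weights \<open>p\<close>, \<open>q\<close>, \<open>r\<close>, \<open>t\<close> join
  i-k, i-l, j-k, j-l. Eliminating the offset between the two pairs leaves two linear relations
  between \<open>ui - uj\<close> and \<open>uk - ul\<close>, which are composed. As A = S x + (p +
  q)(r + t) and B = S y + (p + r)(q + t), these are \<open>S\<close> times the admittances of one
  pair with the other short-circuited. The factor \<open>S\<close> postpones the division by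
  it.\<close>

lemma four_node_admittance:
  fixes x y Z W p q r t ui uj uk ul :: "'a :: field"
  assumes i: "x * (ui - uj) + p * (ui - uk) + q * (ui - ul) = W * (ui - uj)"
    and j: "x * (uj - ui) + r * (uj - uk) + t * (uj - ul) = W * (uj - ui)"
    and k: "(Z + y) * (uk - ul) + p * (uk - ui) + r * (uk - uj) = 0"
    and "ui \<noteq> uj"
    and S: "S = p + q + r + t"
    and A: "A = S * x + p * t + q * r + p * r + q * t"
    and B: "B = S * y + p * t + q * r + p * q + r * t"
  shows "(S * W - A) * (S * Z + B) = - (q * r - p * t)\<^sup>2"
proof -
  have 1: "(S * W - A) * (ui - uj) = (q * r - p * t) * (uk - ul)"
    using i j unfolding A S by algebra
  have 2: "(S * Z + B) * (uk - ul) = (p * t - q * r) * (ui - uj)"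
    using i j k unfolding B S by algebra
  have "((S * W - A) * (S * Z + B) + (q * r - p * t)\<^sup>2) * (ui - uj) = 0"
    using 1 2 by algebra
  with \<open>ui \<noteq> uj\<close> show ?thesis by (simp add: add_eq_0_iff)
qed

lemma admittance_rescale:
  fixes S W Z g11 g12 g22 :: "'a :: field"
  assumes "(S * W - S * g11) * (S * Z + S * g22) = - (S * g12)\<^sup>2" "S \<noteq> 0"
  shows "W * (Z + g22) = g11 * (Z + g22) - g12\<^sup>2"
proof -
  have "S\<^sup>2 * (W * (Z + g22) - (g11 * (Z + g22) - g12\<^sup>2)) = 0"
    using assms(1) by algebra
  with assms(2) show ?thesis by simp
qed

text \<open>\<open>J\<close> collects the forces of everything but the springs, the driving force
  included. Where it vanishes, a node is internal to the spring network and can be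
  eliminated.\<close>

lemma terminal_equations:
  assumes "\<forall>(e, k)\<in>set sp. k \<ge> 0"
    and "finite T" "\<And>n. n \<notin> T \<Longrightarrow> J n = 0"
    and eq: "\<And>n. J n + lap sp u n = 0"
  obtains w :: "nat \<Rightarrow> nat \<Rightarrow> real"
  where "\<And>n m. w n m = w m n" "\<And>n m. w n m \<ge> 0"
    "\<And>n. n \<in> T \<Longrightarrow> J n + (\<Sum>m\<in>T. cst (w n m) * (u n - u m)) = 0"
proof -
  obtain w :: "nat \<Rightarrow> nat \<Rightarrow> real"
  where w: "\<And>n m. w n m = w m n" "\<And>n m. w n m \<ge> 0"
    "\<And>u n. (\<And>n. n \<notin> T \<Longrightarrow> lap sp u n = 0) \<Longrightarrow> n \<in> T \<Longrightarrow>
       lap sp u n = (\<Sum>m\<in>T. cst (w n m) * (u n - u m))"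
    by (rule spring_reduction[OF assms(2,1)]) blast
  have off: "lap sp u n = 0" if "n \<notin> T" for n
    using eq[of n] assms(3)[OF that] by simp
  show ?thesis
  proof (rule that[OF w(1,2)])
    show "J n + (\<Sum>m\<in>T. cst (w n m) * (u n - u m)) = 0" if "n \<in> T" for n
      using eq[of n] w(3)[OF off that] by simp
  qed
qed

lemma one_port_springs:
  assumes "\<forall>(e, k)\<in>set sp. k \<ge> 0"
    and "fst p \<noteq> snd p"
    and "\<And>n. lap sp u n = W * flow u p n" and "velocity_across u p \<noteq> 0"
  obtains g where "g \<ge> 0" "W = cst g"
proof -
  obtain i j where p: "ends p = {i, j}" and ij: "i \<noteq> j" using assms(2) by (auto simp: ends_def)
  obtain w :: "nat \<Rightarrow> nat \<Rightarrow> real" where w: "\<And>n m. w n m \<ge> 0"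
    "\<And>n. n \<in> ends p \<Longrightarrow> - (W * flow u p n) + (\<Sum>m\<in>ends p. cst (w n m) * (u n - u m)) = 0"
    by (rule terminal_equations[OF assms(1), of "ends p" "\<lambda>n. - (W * flow u p n)" u])
       (use assms(3) in \<open>auto simp: flow_off_ends\<close>)
  have "cst (w i j) * (u i - u j) = W * (u i - u j)"
    using w(2)[of i] ij by (simp add: p flow_of_ends[OF p])
  with velocity_across_nonzero[OF p assms(4)] that[of "w i j"] w(1) show ?thesis by auto
qed

text \<open>The springs act as a two-port with real symmetric matrix $(g_{ij})/s$, one port of which is
  terminated; the bounds on \<open>g12\<close> are paramountcy.  If the ports have no common node, eliminating the
  velocity between them gives $g_{12} = (bc - ad)/S$, where $a, b, c, d$ are the cross weights and $S$
  is their sum.\<close>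

lemma two_port_springs:
  assumes sp: "\<forall>(e, k)\<in>set sp. k \<ge> 0"
    and loops: "fst p \<noteq> snd p" "fst q \<noteq> snd q" and pq: "ends p \<noteq> ends q"
    and eq: "\<And>n. Z * flow u q n + lap sp u n = W * flow u p n" and v: "velocity_across u p \<noteq> 0"
  obtains g11 g12 g22 where "\<bar>g12\<bar> \<le> g11" "\<bar>g12\<bar> \<le> g22"
    "W * (Z + cst g22) = cst g11 * (Z + cst g22) - (cst g12)\<^sup>2"
proof -
  define T where "T = ends p \<union> ends q"
  obtain w :: "nat \<Rightarrow> nat \<Rightarrow> real" where sym: "\<And>n m. w n m = w m n" and nonneg: "\<And>n m. w n m \<ge> 0"
    and w: "\<And>n. n \<in> T \<Longrightarrow>
      (Z * flow u q n - W * flow u p n) + (\<Sum>m\<in>T. cst (w n m) * (u n - u m)) = 0"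
    by (rule terminal_equations[OF sp, of T "\<lambda>n. Z * flow u q n - W * flow u p n" u])
       (use eq in \<open>auto simp: T_def flow_off_ends algebra_simps\<close>)
  show ?thesis
  proof (cases "ends p \<inter> ends q = {}")
    case False
    then obtain k where "k \<in> ends p" "k \<in> ends q" by blast
    then obtain i j where p: "ends p = {i, k}" and q: "ends q = {j, k}" and ij: "i \<noteq> k" "j \<noteq> k"
      using other_end loops by metis
    then have dist: "i \<noteq> k" "j \<noteq> k" "i \<noteq> j" using pq by auto
    have T: "T = {i, j, k}" by (auto simp: T_def p q)
    have "W * ((Z + cst (w j k)) + cst (w i j)) =
        cst (w i k) * (Z + cst (w j k)) + (Z + cst (w j k)) * cst (w i j) + cst (w i j) * cst (w i k)"
    proof (rule three_node_admittance)
      show "cst (w i k) * (u i - u k) + cst (w i j) * (u i - u j) = W * (u i - u k)"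
        using w[of i] dist by (simp add: T flow_of_ends[OF p] flow_of_ends[OF q] algebra_simps)
      show "(Z + cst (w j k)) * (u j - u k) + cst (w i j) * (u j - u i) = 0"
        using w[of j] dist sym[of j i] by (simp add: T flow_of_ends[OF p] flow_of_ends[OF q] algebra_simps)
      show "u i \<noteq> u k" by (rule velocity_across_nonzero[OF p v])
    qed
    \<comment> \<open>With a common node the two-port is a delta: the weight \<open>w i j\<close> is
      the coupling \<open>g12\<close>, and adding it to the weights across the ports gives
      \<open>g11\<close> and \<open>g22\<close>, so the bounds are immediate.\<close>
    then show ?thesis
      using that[of "w i j" "w i k + w i j" "w j k + w i j"] nonneg[of i j] nonneg[of i k] nonneg[of j k]
      by (simp add: algebra_simps power2_eq_square)
  next
    case True
    obtain i j where p: "ends p = {i, j}" and ij: "i \<noteq> j" using loops(1) by (auto simp: ends_def)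
    obtain k l where q: "ends q = {k, l}" and kl: "k \<noteq> l" using loops(2) by (auto simp: ends_def)
    have dist: "i \<noteq> j" "i \<noteq> k" "i \<noteq> l" "j \<noteq> k" "j \<noteq> l" "k \<noteq> l" using True p q ij kl by auto
    have T: "T = {i, j, k, l}" by (auto simp: T_def p q)
    have ui: "u i \<noteq> u j" by (rule velocity_across_nonzero[OF p v])
    have Ei: "cst (w i j) * (u i - u j) + cst (w i k) * (u i - u k) + cst (w i l) * (u i - u l) = W * (u i - u j)"
      using w[of i] dist by (simp add: T flow_of_ends[OF p] flow_of_ends[OF q] algebra_simps)
    have Ej: "cst (w i j) * (u j - u i) + cst (w j k) * (u j - u k) + cst (w j l) * (u j - u l) = W * (u j - u i)"
      using w[of j] dist sym[of j i] by (simp add: T flow_of_ends[OF p] flow_of_ends[OF q] algebra_simps)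
    have Ek: "(Z + cst (w k l)) * (u k - u l) + cst (w i k) * (u k - u i) + cst (w j k) * (u k - u j) = 0"
      using w[of k] dist sym[of k i] sym[of k j]
      by (simp add: T flow_of_ends[OF p] flow_of_ends[OF q] algebra_simps)
    define a b c d where "a = w i k" "b = w i l" "c = w j k" "d = w j l"
    note abcd = this
    have nn: "a \<ge> 0" "b \<ge> 0" "c \<ge> 0" "d \<ge> 0" "w i j \<ge> 0" "w k l \<ge> 0" by (simp_all add: abcd nonneg)
    define S where "S = a + b + c + d"
    show ?thesis
    proof (cases "S = 0")
      case True
      then have "a = 0" "b = 0" using nn by (auto simp: S_def)
      \<comment> \<open>Without cross weights the driving port does not feel the termination, and
        the coupling is 0.\<close>
      then have "W = cst (w i j)" using Ei ui by (simp add: abcd)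
      then show ?thesis using that[of 0 "w i j" "w k l"] nn by simp
    next
      case False
      then have S: "S > 0" using nn by (simp add: S_def)
      define A where "A = S * w i j + a * d + b * c + a * c + b * d"
      define B where "B = S * w k l + a * d + b * c + a * b + c * d"
      have SAB: "(cst S * W - cst A) * (cst S * Z + cst B) = - (cst b * cst c - cst a * cst d)\<^sup>2"
        by (rule four_node_admittance[OF Ei Ej Ek ui, folded abcd]) (simp_all add: S_def A_def B_def)
      define g11 g22 g12 where "g11 = A / S" "g22 = B / S" "g12 = (b * c - a * d) / S"
      then have "A = S * g11" "B = S * g22" "b * c - a * d = S * g12"
        using S by simp_all
      then have scaled: "cst A = cst S * cst g11" "cst B = cst S * cst g22"
        "cst b * cst c - cst a * cst d = cst S * cst g12"
        by (metis cst_simps(6), metis cst_simps(6), metis cst_simps(4,6))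
      have "W * (Z + cst g22) = cst g11 * (Z + cst g22) - (cst g12)\<^sup>2"
        by (rule admittance_rescale[OF SAB[unfolded scaled]]) (use S in simp)
      moreover have "\<bar>g12\<bar> \<le> g11" "\<bar>g12\<bar> \<le> g22"
      proof -
        have "\<bar>b * c - a * d\<bar> \<le> b * c + a * d"
          using mult_nonneg_nonneg[OF nn(2,3)] mult_nonneg_nonneg[OF nn(1,4)] by arith
        moreover have "b * c + a * d \<le> A" "b * c + a * d \<le> B"
          using nn S by (simp_all add: A_def B_def)
        ultimately show "\<bar>g12\<bar> \<le> g11" "\<bar>g12\<bar> \<le> g22"
          using S by (simp_all add: g11_g22_g12_def abs_divide divide_right_mono)
      qed
      ultimately show ?thesis using that by blast
    qed
  qed
qed

section \<open>Coefficients of the admittances\<close>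

lemma has_form_iff:
  assumes "a0 \<ge> 0" "a1 \<ge> 0" "a2 \<ge> 0" "a3 \<ge> 0" "b1 \<ge> 0" "b2 \<ge> 0" "b3 \<ge> 0"
    and "b1 > 0 \<or> b2 > 0 \<or> b3 > 0"
  shows "has_form Y a0 a1 a2 a3 b1 b2 b3 \<longleftrightarrow>
    svar * Y * (cst b1 + cst b2 * svar + cst b3 * svar\<^sup>2)
      = cst a0 + cst a1 * svar + cst a2 * svar\<^sup>2 + cst a3 * svar ^ 3"
proof -
  \<comment> \<open>\<open>Fract\<close> with denominator 0 collapses to 0, so this must be excluded
    before denominators are cleared.\<close>
  have "to_fract [:0, b1, b2, b3:] \<noteq> 0" using assms(8) by auto
  then have "has_form Y a0 a1 a2 a3 b1 b2 b3 \<longleftrightarrow>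
      Y * to_fract [:0, b1, b2, b3:] = to_fract [:a0, a1, a2, a3:]"
    using assms(1-7) unfolding has_form_def Fract_eq_divide by (auto simp: eq_divide_eq)
  then show ?thesis
    by (simp add: to_fract_pCons algebra_simps power2_eq_square power3_eq_cube)
qed

lemmas has_formI = has_form_iff[THEN iffD2] and has_formD = has_form_iff[THEN iffD1]

text \<open>The slacks of the last three inequalities are c g12^2, c^2 (g11^2 - g12^2) and c (g22^2
  - g12^2). Here \<open>c\<close> is the damper constant for conditions 2 and 4 and the inertance
  for condition 3.\<close>

lemma paramount_imp_inequalities:
  fixes c g11 g12 g22 :: real
  assumes "c > 0" "\<bar>g12\<bar> \<le> g11" "\<bar>g12\<bar> \<le> g22"
  defines "\<Delta> \<equiv> g11 * g22 - g12\<^sup>2"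
  shows "\<Delta> \<ge> 0" "c * g11 * g22 - \<Delta> * c \<ge> 0" "(c * g11)\<^sup>2 + \<Delta> * c\<^sup>2 \<ge> c * g11 * g22 * c"
    "\<Delta> * c + c * g22\<^sup>2 \<ge> c * g11 * g22"
proof -
  have sq: "g12\<^sup>2 \<le> g11\<^sup>2" "g12\<^sup>2 \<le> g22\<^sup>2"
    using assms(2,3) power_mono[of "\<bar>g12\<bar>" _ 2] by fastforce+
  show "\<Delta> \<ge> 0"
    using mult_mono[OF assms(2,3)] assms(2) by (simp add: \<Delta>_def power2_eq_square abs_mult_self_eq)
  show "c * g11 * g22 - \<Delta> * c \<ge> 0"
    using assms(1) by (simp add: \<Delta>_def algebra_simps)
  have "c\<^sup>2 * (g11\<^sup>2 - g12\<^sup>2) \<ge> 0" using sq by simp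
  then show "(c * g11)\<^sup>2 + \<Delta> * c\<^sup>2 \<ge> c * g11 * g22 * c"
    by (simp add: \<Delta>_def algebra_simps power2_eq_square)
  have "c * (g22\<^sup>2 - g12\<^sup>2) \<ge> 0" using sq assms(1) by simp
  then show "\<Delta> * c + c * g22\<^sup>2 \<ge> c * g11 * g22"
    by (simp add: \<Delta>_def algebra_simps power2_eq_square)
qed

text \<open>Y contains only the square of \<open>g12\<close>, so \<open>g12\<close> may be taken
  nonnegative; the matrix is then that of a delta with weights g11 - g12, g12, g22 - g12. Hence
  three springs suffice even where the two ports of the given network share no node.\<close>

lemma inequalities_imp_springs:
  fixes a0 a1 b1 b2 :: real
  assumes "b2 > 0" "a1 \<ge> 0" "b1 \<ge> 0" "a1 * b1 - a0 * b2 \<ge> 0" "a1\<^sup>2 + a0 * b2\<^sup>2 \<ge> a1 * b1 * b2"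
    "a0 * b2 + b2 * b1\<^sup>2 \<ge> a1 * b1"
  obtains k1 k2 k3 where "k1 \<ge> 0" "k2 \<ge> 0" "k3 \<ge> 0"
    "a1 = b2 * (k1 + k2)" "b1 = k2 + k3" "a0 = k1 * k2 + k2 * k3 + k1 * k3"
proof -
  define h where "h = a1 * b1 / b2 - a0"
  \<comment> \<open>the modulus of the transfer coefficient $g_{12}$, which becomes the coupling spring $k_2$\<close>
  define g where "g = sqrt h"
  have h: "h \<ge> 0" "h \<le> (a1 / b2)\<^sup>2" "h \<le> b1\<^sup>2"
    using assms unfolding h_def by (simp_all add: field_simps power2_eq_square)
  have g: "g \<ge> 0" "g\<^sup>2 = h" "g \<le> a1 / b2" "g \<le> b1"
    using h assms(1-3) real_le_lsqrt[of _ h] by (simp_all add: g_def real_le_lsqrt)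
  show ?thesis
  proof
    show "a1 / b2 - g \<ge> 0" "g \<ge> 0" "b1 - g \<ge> 0" using g by auto
    show "a1 = b2 * (a1 / b2 - g + g)" "b1 = g + (b1 - g)" using assms(1) by auto
    have "a0 = a1 / b2 * b1 - g\<^sup>2" using g(2) by (simp add: h_def)
    then show "a0 = (a1 / b2 - g) * g + g * (b1 - g) + (a1 / b2 - g) * (b1 - g)"
      using assms(1) by (simp add: field_simps power2_eq_square)
  qed
qed

section \<open>Necessity of the coefficient conditions\<close>

definition some_condition :: "ratfun \<Rightarrow> bool" where
  "some_condition Y \<longleftrightarrow> (\<exists>a0 a1 a2 a3 b1 b2 b3. has_form Y a0 a1 a2 a3 b1 b2 b3 \<and>
     (condition1 a0 a1 a2 a3 b1 b2 b3 \<or> condition2 a0 a1 a2 a3 b1 b2 b3 \<or>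
      condition3 a0 a1 a2 a3 b1 b2 b3 \<or> condition4 a0 a1 a2 a3 b1 b2 b3 \<or>
      condition5 a0 a1 a2 a3 b1 b2 b3))"

lemma some_condition_if_parallel_all:
  assumes "b > 0" "c > 0" "g \<ge> 0" "svar * Y = svar * cst c + svar\<^sup>2 * cst b + cst g"
  shows "some_condition Y"
proof -
  have "has_form Y g c b 0 1 0 0"
  proof (rule has_formI)
    show "svar * Y * (cst 1 + cst 0 * svar + cst 0 * svar\<^sup>2)
        = cst g + cst c * svar + cst b * svar\<^sup>2 + cst 0 * svar ^ 3"
      unfolding cst_simps using assms(4) by algebra
  qed (use assms in simp_all)
  moreover have "condition1 g c b 0 1 0 0"
    using assms by (simp add: condition1_def)
  ultimately show ?thesis unfolding some_condition_def by blast
qed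

text \<open>\<open>Z\<close> is s times the admittance terminating the second port. An element
  parallel to the driving port is subtracted from s Y instead, which leaves \<open>W\<close>. The
  cases are damper parallel to inerter, to the port, and inerter parallel to the port.\<close>

lemma some_condition_if_two_port:
  assumes bc: "b > 0" "c > 0" and g: "\<bar>g12\<bar> \<le> g11" "\<bar>g12\<bar> \<le> g22"
    and eq: "W * (Z + cst g22) = cst g11 * (Z + cst g22) - (cst g12)\<^sup>2"
    and cases: "Z = svar * cst c + svar\<^sup>2 * cst b \<and> W = svar * Y \<or>
      Z = svar\<^sup>2 * cst b \<and> W = svar * Y - svar * cst c \<or>
      Z = svar * cst c \<and> W = svar * Y - svar\<^sup>2 * cst b"
  shows "some_condition Y"
proof -
  define \<Delta> where "\<Delta> = g11 * g22 - g12\<^sup>2"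
  note ineqs = paramount_imp_inequalities[OF _ g, folded \<Delta>_def]
  have nn: "g11 \<ge> 0" "g22 \<ge> 0" "\<Delta> \<ge> 0" using g ineqs(1)[of 1] by auto
  have sq: "cst g11 * cst g22 - (cst g12)\<^sup>2 = cst \<Delta>" by (simp add: \<Delta>_def)
  from cases show ?thesis
  proof (elim disjE conjE)
    assume ZW: "Z = svar * cst c + svar\<^sup>2 * cst b" "W = svar * Y"
    have "has_form Y \<Delta> (c * g11) (b * g11) 0 g22 c b"
    proof (rule has_formI)
      show "svar * Y * (cst g22 + cst c * svar + cst b * svar\<^sup>2)
          = cst \<Delta> + cst (c * g11) * svar + cst (b * g11) * svar\<^sup>2 + cst 0 * svar ^ 3"
        using eq sq unfolding ZW cst_simps by algebra
    qed (use bc nn in simp_all)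
    moreover have "condition2 \<Delta> (c * g11) (b * g11) 0 g22 c b"
      using bc ineqs[OF bc(2)] by (simp add: condition2_def)
    ultimately show ?thesis unfolding some_condition_def by blast
  next
    assume ZW: "Z = svar\<^sup>2 * cst b" "W = svar * Y - svar * cst c"
    have "has_form Y \<Delta> (c * g22) (b * g11) (b * c) g22 0 b"
    proof (rule has_formI)
      show "svar * Y * (cst g22 + cst 0 * svar + cst b * svar\<^sup>2)
          = cst \<Delta> + cst (c * g22) * svar + cst (b * g11) * svar\<^sup>2 + cst (b * c) * svar ^ 3"
        using eq sq unfolding ZW cst_simps by algebra
    qed (use bc nn in simp_all)
    moreover have "condition3 \<Delta> (c * g22) (b * g11) (b * c) g22 0 b"
      using bc ineqs[OF bc(1)] by (simp add: condition3_def)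
    ultimately show ?thesis unfolding some_condition_def by blast
  next
    assume ZW: "Z = svar * cst c" "W = svar * Y - svar\<^sup>2 * cst b"
    have "has_form Y \<Delta> (c * g11) (b * g22) (b * c) g22 c 0"
    proof (rule has_formI)
      show "svar * Y * (cst g22 + cst c * svar + cst 0 * svar\<^sup>2)
          = cst \<Delta> + cst (c * g11) * svar + cst (b * g22) * svar\<^sup>2 + cst (b * c) * svar ^ 3"
        using eq sq unfolding ZW cst_simps by algebra
    qed (use bc nn in simp_all)
    moreover have "condition4 \<Delta> (c * g11) (b * g22) (b * c) g22 c 0"
      using bc ineqs[OF bc(2)] by (simp add: condition4_def)
    ultimately show ?thesis unfolding some_condition_def by blast
  qed
qed

lemma some_condition_if_triangle:
  assumes bc: "b > 0" "c > 0" and k: "k1 \<ge> 0" "k2 \<ge> 0" "k3 \<ge> 0"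
    and yz: "y = svar * cst c + cst k2" "z = svar\<^sup>2 * cst b + cst k3"
    and eq: "svar * Y * (y + z) = cst k1 * y + y * z + z * cst k1"
  shows "some_condition Y"
proof -
  let ?a0 = "k1 * k2 + k2 * k3 + k1 * k3"
  have "has_form Y ?a0 (c * (k1 + k3)) (b * (k1 + k2)) (b * c) (k2 + k3) c b"
  proof (rule has_formI)
    show "svar * Y * (cst (k2 + k3) + cst c * svar + cst b * svar\<^sup>2)
        = cst ?a0 + cst (c * (k1 + k3)) * svar + cst (b * (k1 + k2)) * svar\<^sup>2 + cst (b * c) * svar ^ 3"
      using eq unfolding yz cst_simps by algebra
  qed (use bc k in simp_all)
  moreover have "condition5 ?a0 (c * (k1 + k3)) (b * (k1 + k2)) (b * c) (k2 + k3) c b"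
    using bc k by (simp add: condition5_def algebra_simps power2_eq_square)
  ultimately show ?thesis unfolding some_condition_def by blast
qed

lemma some_condition_if_realized:
  assumes valid: "valid_network (one_port D)"
    and Y: "driving_point_admittance (one_port D) Y"
    and X: "\<not> well_defined_admittance (spring_three_port D)"
  shows "some_condition Y"
proof -
  obtain p q r c b where D: "driving_port D = p" "damper D = (q, c)" "inerter D = (r, b)"
    using surj_pair[of "damper D"] surj_pair[of "inerter D"] by blast
  have loops: "fst p \<noteq> snd p" "fst q \<noteq> snd q" "fst r \<noteq> snd r" and bc: "b > 0" "c > 0"
    and sp: "\<forall>(e, k)\<in>set (springs D). k \<ge> 0"
    using valid by (auto simp: valid_network_def one_port_def spring_branches_def D less_imp_le)
  obtain u f where kir: "kirchhoff (one_port D) u [f]" and v: "velocity_across u p \<noteq> 0"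
    and f: "f = Y * velocity_across u p"
  proof -
    have "ports (one_port D) = [p]" by (simp add: one_port_def D)
    with Y show ?thesis unfolding driving_point_admittance_def using that by (metis list.inject)
  qed
  define L where "L = lap (springs D) u"
  have eq: "svar * cst c * flow u q n + svar\<^sup>2 * cst b * flow u r n + L n = svar * Y * flow u p n" for n
  proof -
    have "cst c * flow u q n + cst b * svar * flow u r n + L n / svar = Y * flow u p n"
      using kir unfolding kirchhoff_one_port D f L_def by (simp add: flow_def ac_simps)
    then have "svar * (cst c * flow u q n + cst b * svar * flow u r n + L n / svar)
        = svar * (Y * flow u p n)" by simp
    then show ?thesis by (simp add: algebra_simps power2_eq_square)
  qed
  have two: "some_condition Y"
    if "fst e \<noteq> snd e" "ends p \<noteq> ends e" and "\<And>n. Z * flow u e n + L n = W * flow u p n"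
      and "Z = svar * cst c + svar\<^sup>2 * cst b \<and> W = svar * Y \<or>
        Z = svar\<^sup>2 * cst b \<and> W = svar * Y - svar * cst c \<or>
        Z = svar * cst c \<and> W = svar * Y - svar\<^sup>2 * cst b" for e Z W
    using two_port_springs[OF sp loops(1) that(1-2) that(3)[unfolded L_def] v]
      some_condition_if_two_port[OF bc _ _ _ that(4)] by metis
  have "\<not> (card {p, q, r} = 3 \<and> realizable {p, q, r})"
    using well_defined_if_realizable[OF valid, of "{p, q, r}"] X by (auto simp: D)
  \<comment> \<open>If the set has fewer than three elements, two of the edges coincide and in
    particular are parallel.\<close>
  then have "(ends p = ends q \<or> ends p = ends r \<or> ends q = ends r) \<or> \<not> realizable {p, q, r}"
    by (auto simp: card_insert_if split: if_splits)
  then consider (parallel) "ends p = ends q \<or> ends p = ends r \<or> ends q = ends r"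
    | (triangle) i j k where "i \<noteq> j" "i \<noteq> k" "j \<noteq> k" "ends p = {i, k}" "ends q = {j, k}" "ends r = {i, j}"
    using circuit_of_not_realizable[OF loops] by metis
  then show ?thesis
  proof cases
    case parallel
    then consider (all) "ends p = ends q" "ends p = ends r" | (qr) "ends q = ends r" "ends p \<noteq> ends q"
      | (pq) "ends p = ends q" "ends p \<noteq> ends r" | (pr) "ends p = ends r" "ends p \<noteq> ends q"
      by metis
    then show ?thesis
    proof cases
      case all
      have "L n = (svar * Y - svar * cst c - svar\<^sup>2 * cst b) * flow u p n" for n
        using eq[of n] flow_cong_ends[OF all(1)] flow_cong_ends[OF all(2)]
        by (simp add: algebra_simps)
      then obtain g where "g \<ge> 0" "svar * Y - svar * cst c - svar\<^sup>2 * cst b = cst g"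
        using one_port_springs[OF sp loops(1) _ v] unfolding L_def by metis
      then show ?thesis
        using some_condition_if_parallel_all[OF bc, of g Y] by (simp add: algebra_simps)
    next
      case qr
      show ?thesis
        by (rule two[OF loops(2) qr(2), of "svar * cst c + svar\<^sup>2 * cst b" "svar * Y"])
           (use eq flow_cong_ends[OF qr(1)] in \<open>simp_all add: algebra_simps\<close>)
    next
      case pq
      show ?thesis
      proof (rule two[OF loops(3) pq(2), of "svar\<^sup>2 * cst b" "svar * Y - svar * cst c"])
        show "svar\<^sup>2 * cst b * flow u r n + L n = (svar * Y - svar * cst c) * flow u p n" for n
          using eq[of n] flow_cong_ends[OF pq(1), of u n] by (simp add: algebra_simps)
      qed simp
    next
      case pr
      show ?thesis
      proof (rule two[OF loops(2) pr(2), of "svar * cst c" "svar * Y - svar\<^sup>2 * cst b"])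
        show "svar * cst c * flow u q n + L n = (svar * Y - svar\<^sup>2 * cst b) * flow u p n" for n
          using eq[of n] flow_cong_ends[OF pr(1), of u n] by (simp add: algebra_simps)
      qed simp
    qed
  next
    case triangle
    \<comment> \<open>After the elimination \<open>w i k\<close>, \<open>w j k\<close> and
      \<open>w i j\<close> lie parallel to the port, the damper and the inerter: they are
      \<open>k1\<close>, \<open>k2\<close>, \<open>k3\<close> of network (e).\<close>
    let ?J = "\<lambda>n. svar * cst c * flow u q n + svar\<^sup>2 * cst b * flow u r n - svar * Y * flow u p n"
    obtain w :: "nat \<Rightarrow> nat \<Rightarrow> real" where sym: "\<And>n m. w n m = w m n" and nonneg: "\<And>n m. w n m \<ge> 0"
      and w: "\<And>n. n \<in> {i, j, k} \<Longrightarrow> ?J n + (\<Sum>m\<in>{i, j, k}. cst (w n m) * (u n - u m)) = 0"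
    proof (rule terminal_equations[OF sp, of "{i, j, k}" ?J u])
      show "?J n = 0" if "n \<notin> {i, j, k}" for n
        using that triangle by (simp add: flow_off_ends)
      show "?J n + lap (springs D) u n = 0" for n
        using eq[of n] by (simp add: L_def)
    qed auto
    note fl = flow_of_ends[OF triangle(4)] flow_of_ends[OF triangle(5)] flow_of_ends[OF triangle(6)]
    have "svar * Y * ((svar * cst c + cst (w j k)) + (svar\<^sup>2 * cst b + cst (w i j)))
        = cst (w i k) * (svar * cst c + cst (w j k))
          + (svar * cst c + cst (w j k)) * (svar\<^sup>2 * cst b + cst (w i j))
          + (svar\<^sup>2 * cst b + cst (w i j)) * cst (w i k)"
    proof (rule three_node_admittance)
      show "cst (w i k) * (u i - u k) + (svar\<^sup>2 * cst b + cst (w i j)) * (u i - u j) = svar * Y * (u i - u k)"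
        using w[of i] triangle(1-3) by (simp add: fl algebra_simps)
      show "(svar * cst c + cst (w j k)) * (u j - u k) + (svar\<^sup>2 * cst b + cst (w i j)) * (u j - u i) = 0"
        using w[of j] triangle(1-3) sym[of j i] by (simp add: fl algebra_simps)
      show "u i \<noteq> u k" by (rule velocity_across_nonzero[OF triangle(4) v])
    qed
    then show ?thesis
      by (rule some_condition_if_triangle[OF bc nonneg nonneg nonneg refl refl])
  qed
qed

section \<open>The networks (a) to (e)\<close>

lemma kirchhoff_one_port_scaled:
  "kirchhoff (one_port D) u [f] \<longleftrightarrow>
    (\<forall>n. svar * cst (snd (damper D)) * flow u (fst (damper D)) n
       + svar\<^sup>2 * cst (snd (inerter D)) * flow u (fst (inerter D)) n
       + lap (springs D) u n = incidence n (driving_port D) * (svar * f))"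
proof -
  have "cd + bd * svar * fi + l / svar = i * f \<longleftrightarrow>
      svar * cd + svar\<^sup>2 * bd * fi + l = i * (svar * f)" for cd bd fi l i
  proof -
    have "svar * (cd + bd * svar * fi + l / svar) = svar * cd + svar\<^sup>2 * bd * fi + l"
      by (simp add: distrib_left power2_eq_square ac_simps)
    moreover have "svar * (i * f) = i * (svar * f)" by (rule mult.left_commute)
    ultimately show ?thesis by (metis mult_left_cancel svar_nonzero)
  qed
  then show ?thesis unfolding kirchhoff_one_port by (simp add: mult.assoc)
qed

text \<open>Networks (b) to (e) share one shape: \<open>x\<close> across the port and the series
  connection of \<open>z\<close> and \<open>y\<close> through node 2, each being s times an
  admittance. They differ only in where the damper and the inerter are placed.\<close>

lemma driving_point_admittance_three_node:
  assumes D: "driving_port D = (0, 1)"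
    and eq: "\<And>u n. svar * cst (snd (damper D)) * flow u (fst (damper D)) n
       + svar\<^sup>2 * cst (snd (inerter D)) * flow u (fst (inerter D)) n + lap (springs D) u n
       = x * flow u (0, 1) n + y * flow u (2, 1) n + z * flow u (0, 2) n"
    and yz: "y + z \<noteq> 0" and Y: "svar * Y * (y + z) = x * y + y * z + z * x"
  shows "driving_point_admittance (one_port D) Y"
proof -
  have kir: "kirchhoff (one_port D) u [f] \<longleftrightarrow>
    (\<forall>n. x * flow u (0, 1) n + y * flow u (2, 1) n + z * flow u (0, 2) n
      = incidence n (0, 1) * (svar * f))" for u f
    unfolding kirchhoff_one_port_scaled eq D ..
  \<comment> \<open>The velocity divider at node 2, multiplied by \<open>y + z\<close> to avoid
    fractions.\<close>
  define u :: "nat \<Rightarrow> ratfun" where "u n = (if n = 0 then y + z else if n = 2 then z else 0)" for n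
  have u: "u 0 = y + z" "u 1 = 0" "u 2 = z" by (simp_all add: u_def)
  have "x * flow u (0, 1) n + y * flow u (2, 1) n + z * flow u (0, 2) n
      = incidence n (0, 1) * (svar * (Y * (y + z)))" for n
  proof -
    have n0: "x * (u 0 - u 1) + z * (u 0 - u 2) = svar * (Y * (y + z))"
      unfolding u using Y by algebra
    have n1: "x * (u 1 - u 0) + y * (u 1 - u 2) = - (svar * (Y * (y + z)))"
      unfolding u using Y by algebra
    have n2: "y * (u 2 - u 1) + z * (u 2 - u 0) = 0"
      unfolding u by algebra
    consider "n = 0" | "n = 1" | "n = 2" | "n \<notin> {0, 1, 2}" by blast
    then show ?thesis
    proof cases
      case 1 then show ?thesis using n0 by (simp add: flow_eq incidence_def)
    next
      case 2 then show ?thesis using n1 by (simp add: flow_eq incidence_def)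
    next
      case 3 then show ?thesis using n2 by (simp add: flow_eq incidence_def)
    next
      case 4 then show ?thesis by (simp add: flow_eq incidence_def)
    qed
  qed
  then have "kirchhoff (one_port D) u [Y * (y + z)]" by (simp add: kir)
  moreover have "velocity_across u (0, 1) \<noteq> 0"
    using yz u by (simp add: velocity_across_def)
  moreover have "f = Y * velocity_across u (0, 1)" if "kirchhoff (one_port D) u [f]" for u f
  proof -
    have n0: "x * (u 0 - u 1) + z * (u 0 - u 2) = svar * f"
      using that[unfolded kir, rule_format, of 0] by (simp add: flow_eq incidence_def)
    have n2: "y * (u 2 - u 1) + z * (u 2 - u 0) = 0"
      using that[unfolded kir, rule_format, of 2] by (simp add: flow_eq incidence_def)
    have "(svar * (y + z)) * (f - Y * (u 0 - u 1)) = 0"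
      using n0 n2 Y by algebra
    with yz show ?thesis by (simp add: velocity_across_def)
  qed
  ultimately show ?thesis
    unfolding driving_point_admittance_def by (intro exI[of _ "(0, 1)"]) (auto simp: one_port_def D)
qed

lemma network_a_realizes:
  assumes "Y * svar = svar * cst c + svar\<^sup>2 * cst b + cst k1"
  shows "driving_point_admittance (one_port (network_a b c k1)) Y"
proof -
  have kir: "kirchhoff (one_port (network_a b c k1)) u [f] \<longleftrightarrow>
    (\<forall>n. Y * svar * flow u (0, 1) n = incidence n (0, 1) * (svar * f))" for u f
    unfolding kirchhoff_one_port_scaled assms by (simp add: network_a_def distrib_right)
  define u :: "nat \<Rightarrow> ratfun" where "u n = (if n = 0 then 1 else 0)" for n
  have v: "velocity_across u (0, 1) = 1" by (simp add: u_def velocity_across_def)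
  then have "kirchhoff (one_port (network_a b c k1)) u [Y]"
    unfolding kir by (simp add: flow_def ac_simps)
  moreover have "f = Y * velocity_across u (0, 1)"
    if "kirchhoff (one_port (network_a b c k1)) u [f]" for u f
    using that[unfolded kir, rule_format, of 0] by (simp add: flow_def incidence_def ac_simps)
  ultimately show ?thesis
    unfolding driving_point_admittance_def using v
    by (intro exI[of _ "(0, 1)"]) (auto simp: one_port_def network_a_def)
qed

lemma network_b_realizes:
  assumes "has_form Y (k1 * k2 + k2 * k3 + k1 * k3) (c * (k1 + k2)) (b * (k1 + k2)) 0 (k2 + k3) c b"
    and pos: "b > 0" "c > 0" "k1 \<ge> 0" "k2 \<ge> 0" "k3 \<ge> 0"
  shows "driving_point_admittance (one_port (network_b b c k1 k2 k3)) Y"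
proof (rule driving_point_admittance_three_node)
  let ?x = "cst k1" and ?y = "svar * cst c + svar\<^sup>2 * cst b + cst k3" and ?z = "cst k2"
  show "driving_port (network_b b c k1 k2 k3) = (0, 1)" by (simp add: network_b_def)
  let ?N = "network_b b c k1 k2 k3"
  show "svar * cst (snd (damper ?N)) * flow u (fst (damper ?N)) n
       + svar\<^sup>2 * cst (snd (inerter ?N)) * flow u (fst (inerter ?N)) n + lap (springs ?N) u n
       = ?x * flow u (0, 1) n + ?y * flow u (2, 1) n + ?z * flow u (0, 2) n" for u n
    by (simp add: network_b_def distrib_right)
  \<comment> \<open>Positivity in the ordered field R(s) rules out cancellation.\<close>
  have "svar * cst c > 0" "svar\<^sup>2 * cst b > 0" "cst k2 \<ge> 0" "cst k3 \<ge> 0"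
    using pos by simp_all
  then show "?y + ?z \<noteq> 0" by linarith
  show "svar * Y * (?y + ?z) = ?x * ?y + ?y * ?z + ?z * ?x"
    using has_formD[OF _ _ _ _ _ _ _ _ assms(1)] pos unfolding cst_simps by simp algebra
qed

lemma network_c_realizes:
  assumes "has_form Y (k1 * k2 + k2 * k3 + k1 * k3) (c * (k2 + k3)) (b * (k1 + k2)) (b * c) (k2 + k3) 0 b"
    and pos: "b > 0" "c > 0" "k1 \<ge> 0" "k2 \<ge> 0" "k3 \<ge> 0"
  shows "driving_point_admittance (one_port (network_c b c k1 k2 k3)) Y"
proof (rule driving_point_admittance_three_node)
  let ?x = "svar * cst c + cst k1" and ?y = "svar\<^sup>2 * cst b + cst k3" and ?z = "cst k2"
  show "driving_port (network_c b c k1 k2 k3) = (0, 1)" by (simp add: network_c_def)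
  let ?N = "network_c b c k1 k2 k3"
  show "svar * cst (snd (damper ?N)) * flow u (fst (damper ?N)) n
       + svar\<^sup>2 * cst (snd (inerter ?N)) * flow u (fst (inerter ?N)) n + lap (springs ?N) u n
       = ?x * flow u (0, 1) n + ?y * flow u (2, 1) n + ?z * flow u (0, 2) n" for u n
    by (simp add: network_c_def distrib_right)
  have "svar\<^sup>2 * cst b > 0" "cst k2 \<ge> 0" "cst k3 \<ge> 0"
    using pos by simp_all
  then show "?y + ?z \<noteq> 0" by linarith
  show "svar * Y * (?y + ?z) = ?x * ?y + ?y * ?z + ?z * ?x"
    using has_formD[OF _ _ _ _ _ _ _ _ assms(1)] pos unfolding cst_simps by simp algebra
qed

lemma network_d_realizes:
  assumes "has_form Y (k1 * k2 + k2 * k3 + k1 * k3) (c * (k1 + k2)) (b * (k2 + k3)) (b * c) (k2 + k3) c 0"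
    and pos: "b > 0" "c > 0" "k1 \<ge> 0" "k2 \<ge> 0" "k3 \<ge> 0"
  shows "driving_point_admittance (one_port (network_d b c k1 k2 k3)) Y"
proof (rule driving_point_admittance_three_node)
  let ?x = "svar\<^sup>2 * cst b + cst k1" and ?y = "svar * cst c + cst k3" and ?z = "cst k2"
  show "driving_port (network_d b c k1 k2 k3) = (0, 1)" by (simp add: network_d_def)
  let ?N = "network_d b c k1 k2 k3"
  show "svar * cst (snd (damper ?N)) * flow u (fst (damper ?N)) n
       + svar\<^sup>2 * cst (snd (inerter ?N)) * flow u (fst (inerter ?N)) n + lap (springs ?N) u n
       = ?x * flow u (0, 1) n + ?y * flow u (2, 1) n + ?z * flow u (0, 2) n" for u n
    by (simp add: network_d_def distrib_right)
  have "svar * cst c > 0" "cst k2 \<ge> 0" "cst k3 \<ge> 0"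
    using pos by simp_all
  then show "?y + ?z \<noteq> 0" by linarith
  show "svar * Y * (?y + ?z) = ?x * ?y + ?y * ?z + ?z * ?x"
    using has_formD[OF _ _ _ _ _ _ _ _ assms(1)] pos unfolding cst_simps by simp algebra
qed

lemma network_e_realizes:
  assumes "has_form Y (k1 * k2 + k2 * k3 + k1 * k3) (c * (k1 + k3)) (b * (k1 + k2)) (b * c) (k2 + k3) c b"
    and pos: "b > 0" "c > 0" "k1 \<ge> 0" "k2 \<ge> 0" "k3 \<ge> 0"
  shows "driving_point_admittance (one_port (network_e b c k1 k2 k3)) Y"
proof (rule driving_point_admittance_three_node)
  let ?x = "cst k1" and ?y = "svar * cst c + cst k2" and ?z = "svar\<^sup>2 * cst b + cst k3"
  show "driving_port (network_e b c k1 k2 k3) = (0, 1)" by (simp add: network_e_def)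
  let ?N = "network_e b c k1 k2 k3"
  show "svar * cst (snd (damper ?N)) * flow u (fst (damper ?N)) n
       + svar\<^sup>2 * cst (snd (inerter ?N)) * flow u (fst (inerter ?N)) n + lap (springs ?N) u n
       = ?x * flow u (0, 1) n + ?y * flow u (2, 1) n + ?z * flow u (0, 2) n" for u n
    by (simp add: network_e_def distrib_right)
  have "svar * cst c > 0" "svar\<^sup>2 * cst b > 0" "cst k2 \<ge> 0" "cst k3 \<ge> 0"
    using pos by simp_all
  then show "?y + ?z \<noteq> 0" by linarith
  show "svar * Y * (?y + ?z) = ?x * ?y + ?y * ?z + ?z * ?x"
    using has_formD[OF _ _ _ _ _ _ _ _ assms(1)] pos unfolding cst_simps by simp algebra
qed

lemma not_well_defined_if_unrealizable:
  assumes "length V = length (ports N)" "\<And>u. map (velocity_across u) (ports N) \<noteq> V"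
  shows "\<not> well_defined_admittance N"
  using assms unfolding well_defined_admittance_def by metis

lemmas network_defs = network_a_def network_b_def network_c_def network_d_def network_e_def

lemma networks_valid:
  assumes "b > 0" "c > 0" "k1 \<ge> 0" "k2 \<ge> 0" "k3 \<ge> 0"
    and "D \<in> {network_a b c k1, network_b b c k1 k2 k3, network_c b c k1 k2 k3,
      network_d b c k1 k2 k3, network_e b c k1 k2 k3}"
  shows "valid_network (one_port D)" "length (springs D) \<le> 3"
    "\<not> well_defined_admittance (spring_three_port D)"
proof -
  show "valid_network (one_port D)" "length (springs D) \<le> 3"
    using assms
    by (auto simp: valid_network_def one_port_def spring_branches_def spring_at_def network_defs
        split: if_splits)
  \<comment> \<open>Contradictory velocities must be prescribed on the circuit. In (b) it consists
    of damper and inerter; in the other networks it can be chosen through the driving port.\<close>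
  have "D = network_b b c k1 k2 k3 \<or> D \<noteq> network_b b c k1 k2 k3" by blast
  then show "\<not> well_defined_admittance (spring_three_port D)"
  proof
    assume "D = network_b b c k1 k2 k3"
    then show ?thesis
      by (intro not_well_defined_if_unrealizable[of "[0, 1, 0]"])
         (auto simp: spring_three_port_def velocity_across_def network_defs)
  next
    assume "D \<noteq> network_b b c k1 k2 k3"
    with assms(6) show ?thesis
      by (intro not_well_defined_if_unrealizable[of "[1, 0, 0]"])
         (auto simp: spring_three_port_def velocity_across_def network_defs)
  qed
qed

section \<open>Element values recovered from the coefficients\<close>

lemma condition1_realizable:
  assumes "has_form Y a0 a1 a2 a3 b1 b2 b3" "condition1 a0 a1 a2 a3 b1 b2 b3"
  shows "\<exists>b c k1. b > 0 \<and> c > 0 \<and> k1 \<ge> 0 \<and>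
    driving_point_admittance (one_port (network_a b c k1)) Y"
proof -
  have z: "a3 = 0" "b2 = 0" "b3 = 0" and pos: "a1 > 0" "a2 > 0" "b1 > 0" "a0 \<ge> 0"
    using assms by (auto simp: has_form_def condition1_def)
  have "svar * Y * (cst b1 + cst 0 * svar + cst 0 * svar\<^sup>2)
      = cst a0 + cst a1 * svar + cst a2 * svar\<^sup>2 + cst 0 * svar ^ 3"
    by (rule has_formD[OF _ _ _ _ _ _ _ _ assms(1)[unfolded z]]) (use pos in simp_all)
  then have "svar * Y * cst b1 = cst a0 + cst a1 * svar + cst a2 * svar\<^sup>2" by simp
  moreover have "cst b1 \<noteq> 0" using pos by simp
  ultimately have "Y * svar = svar * cst (a1 / b1) + svar\<^sup>2 * cst (a2 / b1) + cst (a0 / b1)"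
    unfolding cst_divide by (simp add: field_simps)
  from network_a_realizes[OF this] pos show ?thesis
    by (intro exI[of _ "a2 / b1"] exI[of _ "a1 / b1"] exI[of _ "a0 / b1"]) simp
qed

lemma condition2_realizable:
  assumes Y: "has_form Y a0 a1 a2 a3 b1 b2 b3" and "condition2 a0 a1 a2 a3 b1 b2 b3"
  shows "\<exists>b c k1 k2 k3. b > 0 \<and> c > 0 \<and> k1 \<ge> 0 \<and> k2 \<ge> 0 \<and> k3 \<ge> 0 \<and>
    driving_point_admittance (one_port (network_b b c k1 k2 k3)) Y"
proof -
  have c: "b2 > 0" "a1 \<ge> 0" "b1 \<ge> 0" "a1 * b1 - a0 * b2 \<ge> 0" "a1\<^sup>2 + a0 * b2\<^sup>2 \<ge> a1 * b1 * b2"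
    "a0 * b2 + b2 * b1\<^sup>2 \<ge> a1 * b1" "b3 > 0" "a3 = 0" "a1 * b3 = a2 * b2"
    using assms by (auto simp: has_form_def condition2_def)
  obtain k1 k2 k3 where k: "k1 \<ge> 0" "k2 \<ge> 0" "k3 \<ge> 0"
    "a1 = b2 * (k1 + k2)" "b1 = k2 + k3" "a0 = k1 * k2 + k2 * k3 + k1 * k3"
    by (rule inequalities_imp_springs[OF c(1-6)])
  have "a2 = b3 * (k1 + k2)" using c(1,9) k(4) by (simp add: ac_simps)
  then show ?thesis
    using network_b_realizes Y c(1,7,8) k by metis
qed

lemma condition3_realizable:
  assumes Y: "has_form Y a0 a1 a2 a3 b1 b2 b3" and "condition3 a0 a1 a2 a3 b1 b2 b3"
  shows "\<exists>b c k1 k2 k3. b > 0 \<and> c > 0 \<and> k1 \<ge> 0 \<and> k2 \<ge> 0 \<and> k3 \<ge> 0 \<and>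
    driving_point_admittance (one_port (network_c b c k1 k2 k3)) Y"
proof -
  have c: "b3 > 0" "a2 \<ge> 0" "b1 \<ge> 0" "a2 * b1 - a0 * b3 \<ge> 0" "a2\<^sup>2 + a0 * b3\<^sup>2 \<ge> a2 * b1 * b3"
    "a0 * b3 + b3 * b1\<^sup>2 \<ge> a2 * b1" "a3 > 0" "b2 = 0" "a1 * b3 = a3 * b1"
    using assms by (auto simp: has_form_def condition3_def)
  obtain k1 k2 k3 where k: "k1 \<ge> 0" "k2 \<ge> 0" "k3 \<ge> 0"
    "a2 = b3 * (k1 + k2)" "b1 = k2 + k3" "a0 = k1 * k2 + k2 * k3 + k1 * k3"
    by (rule inequalities_imp_springs[OF c(1-6)])
  \<comment> \<open>Y tends to \<open>a3 / b3\<close> for large s, which is the damper across the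
    port.\<close>
  have "a3 / b3 > 0" "a3 = b3 * (a3 / b3)" "a1 = (a3 / b3) * (k2 + k3)"
    using c(1,7,9) k(5) by (simp_all add: field_simps)
  then show ?thesis
    using network_c_realizes Y c(1,8) k by metis
qed

lemma condition4_realizable:
  assumes Y: "has_form Y a0 a1 a2 a3 b1 b2 b3" and "condition4 a0 a1 a2 a3 b1 b2 b3"
  shows "\<exists>b c k1 k2 k3. b > 0 \<and> c > 0 \<and> k1 \<ge> 0 \<and> k2 \<ge> 0 \<and> k3 \<ge> 0 \<and>
    driving_point_admittance (one_port (network_d b c k1 k2 k3)) Y"
proof -
  have c: "b2 > 0" "a1 \<ge> 0" "b1 \<ge> 0" "a1 * b1 - a0 * b2 \<ge> 0" "a1\<^sup>2 + a0 * b2\<^sup>2 \<ge> a1 * b1 * b2"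
    "a0 * b2 + b2 * b1\<^sup>2 \<ge> a1 * b1" "a3 > 0" "b3 = 0" "a3 * b1 = a2 * b2"
    using assms by (auto simp: has_form_def condition4_def)
  obtain k1 k2 k3 where k: "k1 \<ge> 0" "k2 \<ge> 0" "k3 \<ge> 0"
    "a1 = b2 * (k1 + k2)" "b1 = k2 + k3" "a0 = k1 * k2 + k2 * k3 + k1 * k3"
    by (rule inequalities_imp_springs[OF c(1-6)])
  \<comment> \<open>Y grows like \<open>a3 / b2\<close> times s, which is the inerter across the
    port.\<close>
  have "a3 / b2 > 0" "a3 = (a3 / b2) * b2" "a2 = (a3 / b2) * (k2 + k3)"
    using c(1,7,9) k(5) by (simp_all add: field_simps)
  then show ?thesis
    using network_d_realizes Y c(1,8) k by metis
qed

text \<open>In network (e), \<open>x\<close>, \<open>y\<close>, \<open>z\<close> divided by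
  \<open>a3\<close> are the pairwise sums k1 + k3, k1 + k2, k2 + k3. The springs are recovered as
  half of two sums minus the third, like tangent lengths from the sides of a triangle. The quadratic
  equation of condition 5 is a0 = k1 k2 + k2 k3 + k1 k3 multiplied by
  \<open>4 * a3\<^sup>2\<close>.\<close>

lemma condition5_realizable:
  assumes Y: "has_form Y a0 a1 a2 a3 b1 b2 b3" and "condition5 a0 a1 a2 a3 b1 b2 b3"
  shows "\<exists>b c k1 k2 k3. b > 0 \<and> c > 0 \<and> k1 \<ge> 0 \<and> k2 \<ge> 0 \<and> k3 \<ge> 0 \<and>
    driving_point_admittance (one_port (network_e b c k1 k2 k3)) Y"
proof -
  define x y z where "x = a1 * b3" "y = a2 * b2" "z = a3 * b1"
  note xyz = this
  have pos: "a3 > 0" "b2 > 0" "b3 > 0" and a3: "a3 = b3 * b2"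
    and tri: "x + y \<ge> z" "y + z \<ge> x" "x + z \<ge> y"
    and eq: "x\<^sup>2 + y\<^sup>2 + z\<^sup>2 + 4 * a0 * a3\<^sup>2 = 2 * (x * y + y * z + z * x)"
    using assms(2) by (auto simp: condition5_def xyz power_mult_distrib algebra_simps)
  define k1 k2 k3 where "k1 = (x + y - z) / (2 * a3)" "k2 = (y + z - x) / (2 * a3)" "k3 = (x + z - y) / (2 * a3)"
  note k = this
  have nn: "k1 \<ge> 0" "k2 \<ge> 0" "k3 \<ge> 0" using pos tri by (simp_all add: k)
  have sums: "k1 + k3 = x / a3" "k1 + k2 = y / a3" "k2 + k3 = z / a3"
    using pos by (simp_all add: k field_simps)
  have "a1 = b2 * (k1 + k3)" "a2 = b3 * (k1 + k2)" "b1 = k2 + k3"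
    using pos unfolding sums xyz by (simp_all add: a3)
  moreover have "a0 = k1 * k2 + k2 * k3 + k1 * k3"
  proof -
    have "4 * a3\<^sup>2 * (k1 * k2 + k2 * k3 + k1 * k3) =
        (x + y - z) * (y + z - x) + (y + z - x) * (x + z - y) + (x + y - z) * (x + z - y)"
      using pos unfolding k by (simp add: divide_simps power2_eq_square)
    also have "\<dots> = 4 * a3\<^sup>2 * a0" using eq by (simp add: algebra_simps power2_eq_square)
    finally show ?thesis using pos by simp
  qed
  ultimately show ?thesis
    using network_e_realizes Y a3 pos nn by metis
qed

theorem theorem6:
  fixes Y :: ratfun
  assumes "positive_real Y"
  shows
    "((\<exists>D. valid_network (one_port D) \<and> length (springs D) \<le> 3 \<and>
          driving_point_admittance (one_port D) Y \<and>
          \<not> well_defined_admittance (spring_three_port D)) \<longleftrightarrow>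
      (\<exists>a0 a1 a2 a3 b1 b2 b3.
          has_form Y a0 a1 a2 a3 b1 b2 b3 \<and>
          (condition1 a0 a1 a2 a3 b1 b2 b3 \<or>
           condition2 a0 a1 a2 a3 b1 b2 b3 \<or>
           condition3 a0 a1 a2 a3 b1 b2 b3 \<or>
           condition4 a0 a1 a2 a3 b1 b2 b3 \<or>
           condition5 a0 a1 a2 a3 b1 b2 b3))) \<and>
     (\<forall>a0 a1 a2 a3 b1 b2 b3. has_form Y a0 a1 a2 a3 b1 b2 b3 \<longrightarrow>
        (condition1 a0 a1 a2 a3 b1 b2 b3 \<longrightarrow>
           (\<exists>b c k1. b > 0 \<and> c > 0 \<and> k1 \<ge> 0 \<and>
              driving_point_admittance (one_port (network_a b c k1)) Y)) \<and>
        (condition2 a0 a1 a2 a3 b1 b2 b3 \<longrightarrow>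
           (\<exists>b c k1 k2 k3. b > 0 \<and> c > 0 \<and> k1 \<ge> 0 \<and> k2 \<ge> 0 \<and> k3 \<ge> 0 \<and>
              driving_point_admittance (one_port (network_b b c k1 k2 k3)) Y)) \<and>
        (condition3 a0 a1 a2 a3 b1 b2 b3 \<longrightarrow>
           (\<exists>b c k1 k2 k3. b > 0 \<and> c > 0 \<and> k1 \<ge> 0 \<and> k2 \<ge> 0 \<and> k3 \<ge> 0 \<and>
              driving_point_admittance (one_port (network_c b c k1 k2 k3)) Y)) \<and>
        (condition4 a0 a1 a2 a3 b1 b2 b3 \<longrightarrow>
           (\<exists>b c k1 k2 k3. b > 0 \<and> c > 0 \<and> k1 \<ge> 0 \<and> k2 \<ge> 0 \<and> k3 \<ge> 0 \<and>
              driving_point_admittance (one_port (network_d b c k1 k2 k3)) Y)) \<and>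
        (condition5 a0 a1 a2 a3 b1 b2 b3 \<longrightarrow>
           (\<exists>b c k1 k2 k3. b > 0 \<and> c > 0 \<and> k1 \<ge> 0 \<and> k2 \<ge> 0 \<and> k3 \<ge> 0 \<and>
              driving_point_admittance (one_port (network_e b c k1 k2 k3)) Y)))"
    (is "(?realized \<longleftrightarrow> ?form) \<and> ?networks")
proof (intro conjI iffI)
  assume ?realized
  then show ?form using some_condition_if_realized unfolding some_condition_def by blast
next
  assume ?form
  then obtain a0 a1 a2 a3 b1 b2 b3 where Y: "has_form Y a0 a1 a2 a3 b1 b2 b3"
    and cond: "condition1 a0 a1 a2 a3 b1 b2 b3 \<or> condition2 a0 a1 a2 a3 b1 b2 b3 \<or>
      condition3 a0 a1 a2 a3 b1 b2 b3 \<or> condition4 a0 a1 a2 a3 b1 b2 b3 \<or>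
      condition5 a0 a1 a2 a3 b1 b2 b3" by blast
  have realized: ?realized
    if "b > 0" "c > 0" "k1 \<ge> 0" "k2 \<ge> 0" "k3 \<ge> 0"
      and "D \<in> {network_a b c k1, network_b b c k1 k2 k3, network_c b c k1 k2 k3,
        network_d b c k1 k2 k3, network_e b c k1 k2 k3}"
      and "driving_point_admittance (one_port D) Y" for b c k1 k2 k3 D
    using networks_valid[OF that(1-6)] that(7) by blast
  from cond show ?realized
  proof (elim disjE)
    assume "condition1 a0 a1 a2 a3 b1 b2 b3"
    then obtain b c k1 where "b > 0" "c > 0" "k1 \<ge> 0"
      "driving_point_admittance (one_port (network_a b c k1)) Y"
      using condition1_realizable[OF Y] by blast
    then show ?realized by (intro realized[of b c k1 0 0 "network_a b c k1"]) simp_all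
  next
    assume "condition2 a0 a1 a2 a3 b1 b2 b3"
    then obtain b c k1 k2 k3 where "b > 0" "c > 0" "k1 \<ge> 0" "k2 \<ge> 0" "k3 \<ge> 0"
      "driving_point_admittance (one_port (network_b b c k1 k2 k3)) Y"
      using condition2_realizable[OF Y] by blast
    then show ?realized by (intro realized[of b c k1 k2 k3 "network_b b c k1 k2 k3"]) simp_all
  next
    assume "condition3 a0 a1 a2 a3 b1 b2 b3"
    then obtain b c k1 k2 k3 where "b > 0" "c > 0" "k1 \<ge> 0" "k2 \<ge> 0" "k3 \<ge> 0"
      "driving_point_admittance (one_port (network_c b c k1 k2 k3)) Y"
      using condition3_realizable[OF Y] by blast
    then show ?realized by (intro realized[of b c k1 k2 k3 "network_c b c k1 k2 k3"]) simp_all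
  next
    assume "condition4 a0 a1 a2 a3 b1 b2 b3"
    then obtain b c k1 k2 k3 where "b > 0" "c > 0" "k1 \<ge> 0" "k2 \<ge> 0" "k3 \<ge> 0"
      "driving_point_admittance (one_port (network_d b c k1 k2 k3)) Y"
      using condition4_realizable[OF Y] by blast
    then show ?realized by (intro realized[of b c k1 k2 k3 "network_d b c k1 k2 k3"]) simp_all
  next
    assume "condition5 a0 a1 a2 a3 b1 b2 b3"
    then obtain b c k1 k2 k3 where "b > 0" "c > 0" "k1 \<ge> 0" "k2 \<ge> 0" "k3 \<ge> 0"
      "driving_point_admittance (one_port (network_e b c k1 k2 k3)) Y"
      using condition5_realizable[OF Y] by blast
    then show ?realized by (intro realized[of b c k1 k2 k3 "network_e b c k1 k2 k3"]) simp_all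
  qed
next
  show ?networks
    by (intro allI impI conjI)
      (erule (1) condition1_realizable condition2_realizable condition3_realizable
        condition4_realizable condition5_realizable)+
qed

end
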